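(* Let $\kappa$ be a signature wavelet and let $\sigma$ denote the signature with respect to $\kappa$. Let $w$ be a Gaussian white noise with variance $s^2$. Then for every $b\in\mathbb{R}$, $\sigma(w)(b)=0$ with probability $1$. More generally, let $B_\gamma$ be a fractional Brownian motion of order $\gamma\ge0$. Then for every $b\in\mathbb{R}$, $\sigma(B_\gamma)(b)=0$ with probability $1$.
   Context: The Fourier transform is $\widehat f(\omega)=\int_{\mathbb{R}}e^{-i\omega x}f(x)\,dx$, extended to tempered distributions as usual. A signature wavelet is a non-zero complex-valued Schwartz function $\kappa\in\mathscr{S}(\mathbb{R},\mathbb{C})$ such that $\operatorname{supp}\widehat\kappa\subseteq[c,d]$ for some $0<c<d<\infty$ and $\widehat\kappa(\omega)\ge 0$ for all $\omega\in\mathbb{R}$. For $a>0$, $b\in\mathbb{R}$ put $\kappa_{a,b}(x)=\frac{1}{\sqrt a}\,\kappa\left(\frac{x-b}{a}\right)$. The pairing $\langle f,\phi\rangle$ of a tempered distribution with a Schwartz function is bilinear (no complex conjugation), i.e. $\langle f,\phi\rangle=\int f\phi\,dx$ for functions $f$. For $z\in\mathbb{C}\setminus\{0\}$, $\operatorname{sgn} z=z/|z|$, and $\operatorname{sgn}0=0$. The signature of $f$ at $b$ (with respect to $\kappa$) is $\sigma f(b)=\lim_{a\to0+}\operatorname{sgn}\langle f,\kappa_{a,b}\rangle$ if this limit exists in $\mathbb{C}$, and $\sigma f(b)=0$ otherwise. Since $\langle p,\kappa_{a,b}\rangle=0$ for all polynomials $p$, the signature is well defined on $\mathscr{S}'(\mathbb{R})/\mathscr{P}$,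 the tempered distributions modulo the polynomials $\mathscr{P}$; equivalently, the continuous linear functionals on the space of Schwartz functions all of whose moments vanish. Gaussian white noise with variance $s^2$ is a random (real) tempered distribution $w$ whose law $P$ on $\mathscr{S}'(\mathbb{R})$ is the unique probability measure with $\int_{\mathscr{S}'(\mathbb{R})}e^{i\langle\phi,f\rangle}\,dP(f)=e^{-\frac{s^2}{2}\|\phi\|_2^2}$ for all real-valued $\phi\in\mathscr{S}(\mathbb{R})$. For $\gamma\in\mathbb{R}$ the fractional differential operator $D^\gamma$ is defined on $\mathscr{S}'(\mathbb{R})/\mathscr{P}$ by $\widehat{D^\gamma f}(\omega)=(i\omega)^\gamma\,\widehat f(\omega)$, where $(i\omega)^\gamma=|\omega|^\gamma e^{i\gamma\frac{\pi}{2}\operatorname{sgn}\omega}$. A fractional Brownian motion $B_\gamma$ of order $\gamma$ is a solution of $D^\gamma B_\gamma=w$ (in $\mathscr{S}'(\mathbb{R})/\mathscr{P}$), where $w$ is a Gaussian white noise; in particular $B_0=w$. *)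

theory Defs
  imports "HOL-Probability.Probability"
begin

section \<open>Schwartz functions\<close>

definition nth_vderiv :: "nat \<Rightarrow> (real \<Rightarrow> complex) \<Rightarrow> real \<Rightarrow> complex" where
  "nth_vderiv n = (\<lambda>f x. vector_derivative f (at x)) ^^ n"

definition schwartz :: "(real \<Rightarrow> complex) set" where
  "schwartz = {\<phi>. (\<forall>n x. nth_vderiv n \<phi> differentiable (at x)) \<and>
                   (\<forall>k n. bounded (range (\<lambda>x. x ^ k *\<^sub>R nth_vderiv n \<phi> x)))}"

definition schwartz_seminorm :: "nat \<Rightarrow> nat \<Rightarrow> (real \<Rightarrow> complex) \<Rightarrow> real" where
  "schwartz_seminorm k n \<phi> = (SUP x. norm (x ^ k *\<^sub>R nth_vderiv n \<phi> x))"

definition schwartz_topology :: "(real \<Rightarrow> complex) topology" where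
  "schwartz_topology = topology_generated_by
     {{\<psi> \<in> schwartz. schwartz_seminorm k n (\<lambda>x. \<psi> x - \<phi> x) < e} | k n \<phi> e. \<phi> \<in> schwartz \<and> 0 < e}"

definition schwartz_moment0 :: "(real \<Rightarrow> complex) set" where
  "schwartz_moment0 = {\<phi> \<in> schwartz. \<forall>n. (\<integral>x. x ^ n *\<^sub>R \<phi> x \<partial>lborel) = 0}"

text \<open>The Schwartz functions vanishing to infinite order at the origin. The Fourier transform maps this
  space bijectively onto \<^const>\<open>schwartz_moment0\<close>, and so does its inverse.\<close>

definition schwartz_flat0 :: "(real \<Rightarrow> complex) set" where
  "schwartz_flat0 = {\<psi> \<in> schwartz. \<forall>n. nth_vderiv n \<psi> 0 = 0}"

definition fourier :: "(real \<Rightarrow> complex) \<Rightarrow> real \<Rightarrow> complex" where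
  "fourier f \<omega> = (\<integral>x. exp (- \<i> * \<omega> * x) * f x \<partial>lborel)"

definition inv_fourier :: "(real \<Rightarrow> complex) \<Rightarrow> real \<Rightarrow> complex" where
  "inv_fourier g x = 1 / (2 * pi) * (\<integral>\<omega>. exp (\<i> * \<omega> * x) * g \<omega> \<partial>lborel)"

section \<open>Tempered distributions\<close>

text \<open>For a linear subspace \<open>V\<close> of the Schwartz space, \<open>dual_of V\<close> consists of the continuous
  complex-linear functionals on \<open>V\<close>; as total HOL functions they are made \<^const>\<open>extensional\<close>, so
  that equality in \<open>dual_of V\<close> is equality on \<open>V\<close>. The value of a functional \<open>f\<close> at \<open>\<phi>\<close> is the
  bilinear pairing of \<open>f\<close> and \<open>\<phi>\<close>.\<close>

type_synonym functional = "(real \<Rightarrow> complex) \<Rightarrow> complex"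

definition dual_of :: "(real \<Rightarrow> complex) set \<Rightarrow> functional set" where
  "dual_of V = {f \<in> extensional V.
     (\<forall>\<phi>\<in>V. \<forall>\<psi>\<in>V. f (\<lambda>x. \<phi> x + \<psi> x) = f \<phi> + f \<psi>) \<and>
     (\<forall>\<phi>\<in>V. \<forall>c. f (\<lambda>x. c * \<phi> x) = c * f \<phi>) \<and>
     continuous_map (subtopology schwartz_topology V) euclidean f}"

definition tempered :: "functional set" where
  "tempered = dual_of schwartz"

definition real_tempered :: "functional set" where
  "real_tempered = {f \<in> tempered. \<forall>\<phi>\<in>schwartz. range \<phi> \<subseteq> \<real> \<longrightarrow> f \<phi> \<in> \<real>}"

text \<open>The tempered distributions modulo the polynomials, realised as the continuous linear
  functionals on the Schwartz functions with vanishing moments; the quotient map is restriction.\<close>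

definition tempered_mod_poly :: "functional set" where
  "tempered_mod_poly = dual_of schwartz_moment0"

definition mod_poly :: "functional \<Rightarrow> functional" where
  "mod_poly f = restrict f schwartz_moment0"

section \<open>Fractional derivatives modulo polynomials\<close>

text \<open>The Fourier transform of a distribution modulo polynomials is a functional on
  \<^const>\<open>schwartz_flat0\<close>, a space invariant under multiplication with \<open>(\<i> \<omega>)\<^sup>\<gamma>\<close> for every real
  \<open>\<gamma>\<close>. The transform, its inverse and the multiplication all act by transposition. The convention \<open>0 powr \<gamma> = 0\<close> is harmless
  because the multiplier is only ever applied to functions vanishing at the origin.\<close>

definition fourier_dist :: "functional \<Rightarrow> functional" where
  "fourier_dist f = (\<lambda>\<psi>\<in>schwartz_flat0. f (fourier \<psi>))"

definition inv_fourier_dist :: "functional \<Rightarrow> functional" where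
  "inv_fourier_dist g = (\<lambda>\<phi>\<in>schwartz_moment0. g (inv_fourier \<phi>))"

definition mult_dist :: "(real \<Rightarrow> complex) \<Rightarrow> functional \<Rightarrow> functional" where
  "mult_dist m g = (\<lambda>\<psi>\<in>schwartz_flat0. g (\<lambda>\<omega>. m \<omega> * \<psi> \<omega>))"

definition frac_multiplier :: "real \<Rightarrow> real \<Rightarrow> complex" where
  "frac_multiplier \<gamma> \<omega> = (\<bar>\<omega>\<bar> powr \<gamma>) *\<^sub>R exp (\<i> * \<gamma> * (pi / 2) * sgn \<omega>)"

definition frac_D :: "real \<Rightarrow> functional \<Rightarrow> functional" where
  "frac_D \<gamma> f = inv_fourier_dist (mult_dist (frac_multiplier \<gamma>) (fourier_dist f))"

section \<open>Wavelets and signature\<close>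

definition signature_wavelet :: "(real \<Rightarrow> complex) \<Rightarrow> bool" where
  "signature_wavelet \<kappa> \<longleftrightarrow> \<kappa> \<in> schwartz \<and> \<kappa> \<noteq> (\<lambda>x. 0) \<and>
     (\<exists>c d. 0 < c \<and> c < d \<and> closure {\<omega>. fourier \<kappa> \<omega> \<noteq> 0} \<subseteq> {c..d}) \<and>
     (\<forall>\<omega>. fourier \<kappa> \<omega> \<in> \<real>\<^sub>\<ge>\<^sub>0)"

definition wavelet :: "(real \<Rightarrow> complex) \<Rightarrow> real \<Rightarrow> real \<Rightarrow> real \<Rightarrow> complex" where
  "wavelet \<kappa> a b x = (1 / sqrt a) *\<^sub>R \<kappa> ((x - b) / a)"

text \<open>Since the wavelets \<open>wavelet \<kappa> a b\<close> of a signature wavelet lie in \<^const>\<open>schwartz_moment0\<close>, the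
  same expression serves for tempered distributions and for their classes modulo polynomials.\<close>

definition signature :: "(real \<Rightarrow> complex) \<Rightarrow> functional \<Rightarrow> real \<Rightarrow> complex" where
  "signature \<kappa> f b =
     (if \<exists>l. ((\<lambda>a. sgn (f (wavelet \<kappa> a b))) \<longlongrightarrow> l) (at_right 0)
      then Lim (at_right 0) (\<lambda>a. sgn (f (wavelet \<kappa> a b))) else 0)"

section \<open>White noise and fractional Brownian motion\<close>

text \<open>Spaces of functionals on \<open>V\<close> carry the cylinder sigma-algebra, which is generated by the
  evaluations at the elements of \<open>V\<close>.\<close>

definition cylinder_space :: "(real \<Rightarrow> complex) set \<Rightarrow> functional set \<Rightarrow> functional measure" where
  "cylinder_space V F = restrict_space (Pi\<^sub>M V (\<lambda>_. borel)) F"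

definition gaussian_white_noise ::
    "'a measure \<Rightarrow> real \<Rightarrow> ('a \<Rightarrow> functional) \<Rightarrow> bool" where
  "gaussian_white_noise M s w \<longleftrightarrow>
     prob_space M \<and>
     w \<in> M \<rightarrow>\<^sub>M cylinder_space schwartz real_tempered \<and>
     (\<forall>\<phi>\<in>schwartz. range \<phi> \<subseteq> \<real> \<longrightarrow>
        (\<integral>f. exp (\<i> * f \<phi>) \<partial>(distr M (cylinder_space schwartz real_tempered) w)) =
        exp (- (s\<^sup>2 / 2) * (\<integral>x. (cmod (\<phi> x))\<^sup>2 \<partial>lborel)))"

definition fractional_brownian_motion ::
    "'a measure \<Rightarrow> real \<Rightarrow> ('a \<Rightarrow> functional) \<Rightarrow> bool" where
  "fractional_brownian_motion M \<gamma> B \<longleftrightarrow>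
     B \<in> M \<rightarrow>\<^sub>M cylinder_space schwartz_moment0 tempered_mod_poly \<and>
     (\<exists>s w. gaussian_white_noise M s w \<and> (AE \<xi> in M. frac_D \<gamma> (B \<xi>) = mod_poly (w \<xi>)))"

end

theory Submission
  imports Defs
begin

text \<open>White noise is scale invariant: rescaling a test function by \<open>a\<close> (with the factor \<open>1 / sqrt a\<close>)
  preserves its \<open>L\<^sup>2\<close> norm, so the values of the noise on the real parts of the dilates of a Schwartz
  function \<open>\<theta>\<close> are centred Gaussians of one common variance. Dilates at very different scales are almost
  orthogonal, hence almost independent. Along a sequence of scales tending to \<open>0\<close> fast enough, almost
  surely infinitely many of these values are therefore \<open>\<le> 0\<close>. If the signs of the complex values had
  a limit \<open>l \<noteq> 0\<close>, then for some \<open>c \<in> {1, -1, \<i>, -\<i>}\<close> the real part of \<open>c * l\<close> would be positive, and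
  the noise would eventually be positive on the real parts of the dilates of \<open>c * \<theta>\<close>. So the only
  possible limit is \<open>0\<close> (lemma \<open>white_noise_sgn_limit\<close>).

  Only characteristic functions of single values and of differences of two values are needed. Let
  \<open>A\<close> be the event that \<open>X n > 0\<close> for all \<open>n \<ge> k\<close>. The centred characters
  \<open>exp (\<i> * t * X n) - exp (- t\<^sup>2 / 2)\<close> are almost orthogonal in \<open>L\<^sup>2\<close>, so a Bessel inequality makes their
  integrals over \<open>A\<close> tend to \<open>0\<close>. If \<open>A\<close> had positive probability, then under the conditional
  measure given \<open>A\<close> the \<open>X n\<close> would converge in distribution to a standard Gaussian by Levy's
  continuity theorem, although they are eventually positive there
  (lemma \<open>gaussian_infinitely_often_nonpos\<close>).

  Fractional Brownian motion reduces to white noise for a different wavelet. The Fourier side of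
  \<open>\<kappa>\<close> is a smooth function with compact support away from the origin, so it can be divided by the
  multiplier \<open>(\<i> \<omega>)\<^sup>\<gamma>\<close>; the quotient is the Fourier side of a Schwartz function \<open>\<theta>\<close>. By homogeneity
  of the multiplier, \<open>B\<close> on the dilate of \<open>\<kappa>\<close> at scale \<open>a\<close> equals \<open>a powr \<gamma>\<close> times \<open>w\<close> on the dilate of
  \<open>\<theta>\<close>, with the same sign (lemma \<open>fractional_integral_wavelet\<close>).\<close>

section \<open>Almost orthogonal Gaussian sequences\<close>

text \<open>Schur's test bounds the Gram matrix by its row sums \<open>R\<close>; expanding the nonnegative square norm of
  \<open>h - S / R\<close>, where \<open>S\<close> is the sum of the \<open>Y n\<close> weighted by the conjugate coefficients of \<open>h\<close>, gives the
  bound.\<close>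

lemma (in prob_space) bessel_almost_orthogonal:
  fixes Y :: "nat \<Rightarrow> 'a \<Rightarrow> complex" and h :: "'a \<Rightarrow> real" and K :: "nat \<Rightarrow> nat \<Rightarrow> real"
  assumes [measurable]: "\<And>n. Y n \<in> borel_measurable M" "h \<in> borel_measurable M"
    and bY: "\<And>n x. cmod (Y n x) \<le> B" and bh: "\<And>x. \<bar>h x\<bar> \<le> 1"
    and gram: "\<And>n m. cmod (\<integral>x. Y n x * cnj (Y m x) \<partial>M) \<le> K n m"
    and sym: "\<And>n m. K n m = K m n" and row: "\<And>n. (\<Sum>m<N. K n m) \<le> R" and R: "R > 0"
  shows "(\<Sum>n<N. (cmod (\<integral>x. of_real (h x) * Y n x \<partial>M))\<^sup>2) \<le> R"
proof -
  define c where "c n = (\<integral>x. of_real (h x) * Y n x \<partial>M)" for n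
  define Q where "Q = (\<Sum>n<N. (cmod (c n))\<^sup>2)"
  define S where "S x = (\<Sum>n<N. cnj (c n) * Y n x)" for x
  have [measurable]: "cnj \<in> borel \<rightarrow>\<^sub>M borel"
    by (intro borel_measurable_continuous_onI continuous_intros)
  have B0: "B \<ge> 0" using bY[of 0 undefined] norm_ge_zero order_trans by blast
  have [measurable]: "S \<in> borel_measurable M" unfolding S_def by measurable
  have int1: "integrable M (\<lambda>x. of_real (h x) * Y n x)" for n
  proof (rule integrable_const_bound[where B="1 * B"])
    show "AE x in M. cmod (complex_of_real (h x) * Y n x) \<le> 1 * B"
      unfolding norm_mult by (intro AE_I2 mult_mono) (use bY bh B0 in simp_all)
  qed measurable
  have int2: "integrable M (\<lambda>x. Y n x * cnj (Y m x))" for n m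
  proof (rule integrable_const_bound[where B="B * B"])
    show "AE x in M. cmod (Y n x * cnj (Y m x)) \<le> B * B"
      unfolding norm_mult complex_mod_cnj by (intro AE_I2 mult_mono) (use bY bh B0 in simp_all)
  qed measurable
  have hS: "(\<integral>x. of_real (h x) * S x \<partial>M) = of_real Q"
  proof -
    have "(\<integral>x. of_real (h x) * S x \<partial>M) = (\<integral>x. (\<Sum>n<N. cnj (c n) * (of_real (h x) * Y n x)) \<partial>M)"
      unfolding S_def by (simp add: sum_distrib_left mult_ac)
    also have "\<dots> = (\<Sum>n<N. cnj (c n) * c n)"
      unfolding c_def using int1 by (subst Bochner_Integration.integral_sum) auto
    also have "\<dots> = of_real Q"
      unfolding Q_def by (simp only: of_real_sum complex_norm_square mult.commute)
    finally show ?thesis .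
  qed
  have ihS: "integrable M (\<lambda>x. of_real (h x) * S x)"
  proof -
    have "(\<lambda>x. of_real (h x) * S x) = (\<lambda>x. \<Sum>n<N. cnj (c n) * (of_real (h x) * Y n x))"
      unfolding S_def by (simp add: sum_distrib_left mult_ac)
    then show ?thesis using int1 by simp
  qed
  have SS: "S x * cnj (S x) = (\<Sum>n<N. \<Sum>m<N. cnj (c n) * c m * (Y n x * cnj (Y m x)))" for x
    unfolding S_def cnj_sum sum_product by (simp add: mult_ac)
  have iSS: "integrable M (\<lambda>x. S x * cnj (S x))"
    unfolding SS using int2 by auto
  have iS2: "integrable M (\<lambda>x. (cmod (S x))\<^sup>2)"
    using integrable_Re[OF iSS] by (simp only: complex_norm_square[symmetric] Re_complex_of_real)
  have "cmod (\<integral>x. S x * cnj (S x) \<partial>M) \<le> R * Q"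
  proof -
    have "(\<integral>x. S x * cnj (S x) \<partial>M) = (\<Sum>n<N. \<Sum>m<N. cnj (c n) * c m * (\<integral>x. Y n x * cnj (Y m x) \<partial>M))"
      unfolding SS using int2 by (subst Bochner_Integration.integral_sum; (subst Bochner_Integration.integral_sum)?) auto
    also have "cmod \<dots> \<le> (\<Sum>n<N. \<Sum>m<N. cmod (c n) * cmod (c m) * K n m)"
      by (intro sum_norm_le order_refl) (use gram in \<open>auto simp: norm_mult intro!: mult_left_mono\<close>)
    also have "\<dots> \<le> (\<Sum>n<N. \<Sum>m<N. ((cmod (c n))\<^sup>2 / 2 + (cmod (c m))\<^sup>2 / 2) * K n m)"
    proof (intro sum_mono mult_right_mono)
      fix n m
      show "cmod (c n) * cmod (c m) \<le> (cmod (c n))\<^sup>2 / 2 + (cmod (c m))\<^sup>2 / 2"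
        using sum_squares_bound[of "cmod (c n)" "cmod (c m)"] by simp
      show "0 \<le> K n m" using gram[of n m] norm_ge_zero order_trans by blast
    qed
    also have "\<dots> = (\<Sum>n<N. \<Sum>m<N. (cmod (c n))\<^sup>2 / 2 * K n m) + (\<Sum>n<N. \<Sum>m<N. (cmod (c m))\<^sup>2 / 2 * K n m)"
      by (simp add: distrib_right sum.distrib)
    also have "(\<Sum>n<N. \<Sum>m<N. (cmod (c m))\<^sup>2 / 2 * K n m) = (\<Sum>n<N. \<Sum>m<N. (cmod (c n))\<^sup>2 / 2 * K n m)"
      by (subst sum.swap) (simp add: sym)
    also have "(\<Sum>n<N. \<Sum>m<N. (cmod (c n))\<^sup>2 / 2 * K n m) + (\<Sum>n<N. \<Sum>m<N. (cmod (c n))\<^sup>2 / 2 * K n m)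
       = (\<Sum>n<N. (cmod (c n))\<^sup>2 * (\<Sum>m<N. K n m))"
      by (simp add: sum.distrib[symmetric] sum_distrib_left) (simp add: mult.commute)
    also have "\<dots> \<le> (\<Sum>n<N. (cmod (c n))\<^sup>2 * R)"
      by (intro sum_mono mult_left_mono row) auto
    also have "\<dots> = R * Q" unfolding Q_def by (simp add: sum_distrib_left mult.commute)
    finally show ?thesis .
  qed
  moreover have "(\<integral>x. S x * cnj (S x) \<partial>M) = of_real (\<integral>x. (cmod (S x))\<^sup>2 \<partial>M)"
    by (simp only: complex_norm_square[symmetric] integral_complex_of_real)
  ultimately have S2: "(\<integral>x. (cmod (S x))\<^sup>2 \<partial>M) \<le> R * Q" by simp
  have ReS: "(\<integral>x. h x * Re (S x) \<partial>M) = Q" "integrable M (\<lambda>x. h x * Re (S x))"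
    using integral_Re[OF ihS] integrable_Re[OF ihS] hS by simp_all
  have ih: "integrable M (\<lambda>x. (h x)\<^sup>2)"
    by (rule integrable_const_bound[where B=1]) (use bh in \<open>auto simp: abs_square_le_1\<close>)
  have h1: "(\<integral>x. (h x)\<^sup>2 \<partial>M) \<le> 1"
    using integral_mono[OF ih, of "\<lambda>_. 1"] bh by (simp add: abs_square_le_1 prob_space)
  have "0 \<le> (\<integral>x. (cmod (of_real (h x) - S x / R))\<^sup>2 \<partial>M)" by simp
  also have "(\<lambda>x. (cmod (of_real (h x) - S x / R))\<^sup>2)
     = (\<lambda>x. (h x)\<^sup>2 - 2 / R * (h x * Re (S x)) + (1/R\<^sup>2) * (cmod (S x))\<^sup>2)"
    unfolding cmod_power2 using R by (simp add: fun_eq_iff power2_eq_square field_simps)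
  also have "(\<integral>x. (h x)\<^sup>2 - 2 / R * (h x * Re (S x)) + (1/R\<^sup>2) * (cmod (S x))\<^sup>2 \<partial>M)
     = (\<integral>x. (h x)\<^sup>2 \<partial>M) - 2 / R * Q + (1/R\<^sup>2) * (\<integral>x. (cmod (S x))\<^sup>2 \<partial>M)"
    using ih ReS iS2 by simp
  also have "\<dots> \<le> 1 - 2 / R * Q + (1/R\<^sup>2) * (R * Q)"
    using h1 S2 R by (intro add_mono diff_mono mult_left_mono) auto
  also have "\<dots> = 1 - Q / R" using R by (simp add: field_simps power2_eq_square)
  finally have "Q \<le> R" using R by (simp add: field_simps)
  then show ?thesis unfolding Q_def c_def .
qed

lemma (in prob_space) almost_orthogonal_weakly_null:
  fixes Y :: "nat \<Rightarrow> 'a \<Rightarrow> complex" and h :: "'a \<Rightarrow> real" and K :: "nat \<Rightarrow> nat \<Rightarrow> real"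
  assumes "\<And>n. Y n \<in> borel_measurable M" "h \<in> borel_measurable M"
    and "\<And>n x. cmod (Y n x) \<le> B" and "\<And>x. \<bar>h x\<bar> \<le> 1"
    and "\<And>n m. cmod (\<integral>x. Y n x * cnj (Y m x) \<partial>M) \<le> K n m"
    and "\<And>n m. K n m = K m n" and row: "\<And>n N. (\<Sum>m<N. K n m) \<le> R" and "R > 0"
  shows "(\<lambda>n. \<integral>x. of_real (h x) * Y n x \<partial>M) \<longlonglongrightarrow> 0"
proof -
  have "summable (\<lambda>n. (cmod (\<integral>x. of_real (h x) * Y n x \<partial>M))\<^sup>2)"
    by (rule summableI_nonneg_bounded[where x=R]) (use bessel_almost_orthogonal[OF assms] in auto)
  then have "(\<lambda>n. (cmod (\<integral>x. of_real (h x) * Y n x \<partial>M))\<^sup>2) \<longlonglongrightarrow> 0"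
    by (rule summable_LIMSEQ_zero)
  then have "(\<lambda>n. sqrt ((cmod (\<integral>x. of_real (h x) * Y n x \<partial>M))\<^sup>2)) \<longlonglongrightarrow> sqrt 0"
    by (rule tendsto_real_sqrt)
  then show ?thesis by (simp add: tendsto_norm_zero_iff)
qed

text \<open>For \<open>n \<noteq> m\<close> the covariance of the two centred characters is
  \<open>exp (- t\<^sup>2) * (exp (t\<^sup>2 * \<rho> n m) - 1)\<close>, which is of the order of the correlation \<open>\<rho> n m\<close> and thus has
  bounded row sums.\<close>

lemma (in prob_space) gaussian_weakly_mixing:
  fixes X :: "nat \<Rightarrow> 'a \<Rightarrow> real" and \<rho> :: "nat \<Rightarrow> nat \<Rightarrow> real"
  assumes [measurable]: "\<And>n. X n \<in> borel_measurable M" "h \<in> borel_measurable M"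
    and bh: "\<And>x. \<bar>h x\<bar> \<le> 1"
    and char1: "\<And>n t. (\<integral>x. iexp (t * X n x) \<partial>M) = of_real (exp (- t\<^sup>2 / 2))"
    and char2: "\<And>n m t. (\<integral>x. iexp (t * (X n x - X m x)) \<partial>M) = of_real (exp (- t\<^sup>2 * (1 - \<rho> n m)))"
    and rho1: "\<And>n m. \<bar>\<rho> n m\<bar> \<le> 1"
    and rho: "\<And>n m. n \<noteq> m \<Longrightarrow> \<bar>\<rho> n m\<bar> \<le> C * (1/2) ^ (n + m)"
  shows "(\<lambda>n. \<integral>x. of_real (h x) * (iexp (t * X n x) - of_real (exp (- t\<^sup>2 / 2))) \<partial>M) \<longlonglongrightarrow> 0"
proof -
  define \<mu> where "\<mu> = exp (- t\<^sup>2 / 2)"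
  have mu: "0 < \<mu>" "\<mu> \<le> 1" "\<mu> * \<mu> = exp (- t\<^sup>2)"
    unfolding \<mu>_def by (auto simp flip: exp_add)
  have "0 \<le> \<bar>\<rho> 0 1\<bar>" by simp
  also have "\<dots> \<le> C * (1/2)" using rho[of 0 1] by simp
  finally have C: "C \<ge> 0" by simp
  \<comment> \<open>The constant 4 bounds the diagonal: a centred character has modulus at most 2.\<close>
  define K where "K n m = (if n = m then 4 else 0) + t\<^sup>2 * (C * (1/2)^(n+m))" for n m :: nat
  have int: "integrable M (\<lambda>x. iexp (t * f x))" if [measurable]: "f \<in> borel_measurable M" for t f
    by (rule integrable_const_bound[where B=1]) auto
  show ?thesis unfolding \<mu>_def[symmetric]
  proof (rule almost_orthogonal_weakly_null[where B=2 and K=K and R="4 + 2 * t\<^sup>2 * C"])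
    show "cmod (iexp (t * X n x) - of_real \<mu>) \<le> 2" for n x
      using norm_triangle_ineq4[of "iexp (t * X n x)" "of_real \<mu>"] mu by simp
    show "cmod (\<integral>x. (iexp (t * X n x) - of_real \<mu>) * cnj (iexp (t * X m x) - of_real \<mu>) \<partial>M) \<le> K n m" for n m
    proof -
      have eq: "(iexp (t * X n x) - of_real \<mu>) * cnj (iexp (t * X m x) - of_real \<mu>)
        = iexp (t * (X n x - X m x)) - of_real \<mu> * iexp (t * X n x) - of_real \<mu> * iexp ((-t) * X m x) + of_real (\<mu> * \<mu>)" for x
        by (simp add: algebra_simps exp_cnj exp_diff exp_minus exp_add flip: of_real_mult)
           (simp add: field_simps)
      have "(\<integral>x. (iexp (t * X n x) - of_real \<mu>) * cnj (iexp (t * X m x) - of_real \<mu>) \<partial>M)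
        = of_real (exp (- t\<^sup>2 * (1 - \<rho> n m)) - \<mu> * \<mu> - \<mu> * \<mu> + \<mu> * \<mu>)"
        unfolding eq
        using int[of "\<lambda>x. X n x - X m x" t] int[of "X n" t] int[of "X m" "-t"]
          char1[of t n] char1[of "-t" m] char2[of t n m]
        by (simp add: \<mu>_def prob_space del: of_real_mult of_real_minus) (simp only: of_real_mult)
      also have "exp (- t\<^sup>2 * (1 - \<rho> n m)) - \<mu> * \<mu> - \<mu> * \<mu> + \<mu> * \<mu> = exp (- t\<^sup>2) * (exp (t\<^sup>2 * \<rho> n m) - 1)"
        unfolding mu by (simp add: algebra_simps flip: exp_add)
      finally have E: "cmod (\<integral>x. (iexp (t * X n x) - of_real \<mu>) * cnj (iexp (t * X m x) - of_real \<mu>) \<partial>M)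
         = exp (- t\<^sup>2) * \<bar>exp (t\<^sup>2 * \<rho> n m) - 1\<bar>"
        by (simp only: norm_of_real abs_mult) simp
      have r: "t\<^sup>2 * \<bar>\<rho> n m\<bar> \<le> t\<^sup>2" using rho1[of n m] by (simp add: mult_left_le)
      have ab: "\<bar>exp y - 1\<bar> \<le> \<bar>y\<bar> * exp \<bar>y\<bar>" for y :: real
      proof (cases "y \<ge> 0")
        case True
        have "1 - y \<le> exp (-y)" using exp_ge_add_one_self[of "-y"] by simp
        then have "(1 - y) * exp y \<le> exp (-y) * exp y" by (rule mult_right_mono) simp
        then show ?thesis using True by (simp add: algebra_simps flip: exp_add)
      next
        case False
        have "1 - exp y \<le> - y" using exp_ge_add_one_self[of y] by linarith
        moreover have "- y * 1 \<le> - y * exp (-y)" using False by (intro mult_left_mono) auto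
        moreover have "exp y \<le> 1" using False by simp
        ultimately have "1 - exp y \<le> - y * exp (- y)" "exp y \<le> 1" by linarith+
        then show ?thesis using False by simp
      qed
      have "exp (- t\<^sup>2) * \<bar>exp (t\<^sup>2 * \<rho> n m) - 1\<bar> \<le> exp (- t\<^sup>2) * ((t\<^sup>2 * \<bar>\<rho> n m\<bar>) * exp (t\<^sup>2 * \<bar>\<rho> n m\<bar>))"
        using ab[of "t\<^sup>2 * \<rho> n m"] by (intro mult_left_mono) (auto simp: abs_mult)
      also have "\<dots> \<le> exp (- t\<^sup>2) * ((t\<^sup>2 * \<bar>\<rho> n m\<bar>) * exp (t\<^sup>2))"
        using r by (intro mult_left_mono) auto
      also have "\<dots> = t\<^sup>2 * \<bar>\<rho> n m\<bar>" by (simp add: exp_minus)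
      finally have b1: "exp (- t\<^sup>2) * \<bar>exp (t\<^sup>2 * \<rho> n m) - 1\<bar> \<le> t\<^sup>2 * \<bar>\<rho> n m\<bar>" .
      show ?thesis
      proof (cases "n = m")
        case True
        have "exp (- t\<^sup>2) * \<bar>exp (t\<^sup>2 * \<rho> n m) - 1\<bar> \<le> exp (- t\<^sup>2) * (exp (t\<^sup>2) + 1)"
        proof (intro mult_left_mono)
          have "t\<^sup>2 * \<rho> n m \<le> t\<^sup>2" using r abs_le_D1[of "t\<^sup>2 * \<rho> n m"] by (simp add: abs_mult)
          then have "exp (t\<^sup>2 * \<rho> n m) \<le> exp (t\<^sup>2)" by simp
          then show "\<bar>exp (t\<^sup>2 * \<rho> n m) - 1\<bar> \<le> exp (t\<^sup>2) + 1"
            using exp_gt_zero[of "t\<^sup>2 * \<rho> n m"] by linarith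
        qed simp
        also have "\<dots> = 1 + exp (- t\<^sup>2)" by (simp add: algebra_simps flip: exp_add)
        also have "\<dots> \<le> 4" using mu(2) by (simp add: order_trans[of _ 1])
        also have "\<dots> \<le> K n m" using True C by (simp add: K_def)
        finally show ?thesis unfolding E .
      next
        case False
        then show ?thesis unfolding E K_def
          using b1 mult_left_mono[OF rho[OF False], of "t\<^sup>2"] by simp
      qed
    qed
    show "K n m = K m n" for n m by (auto simp: K_def add.commute)
    show "(\<Sum>m<N. K n m) \<le> 4 + 2 * t\<^sup>2 * C" for n N
    proof -
      have "(\<Sum>m<N. K n m) = (\<Sum>m<N. if n = m then 4 else 0) + t\<^sup>2 * C * ((1/2)^n * (\<Sum>m<N. (1/2)^m))"
        unfolding K_def by (simp add: sum.distrib sum_distrib_left power_add mult_ac)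
      also have "\<dots> \<le> 4 + t\<^sup>2 * C * (1 * 2)"
      proof (intro add_mono mult_left_mono mult_mono)
        show "(\<Sum>m<N. if n = m then 4 else 0) \<le> (4::real)" by (simp add: sum.delta')
        show "(\<Sum>m<N. (1/2::real)^m) \<le> 2" by (simp add: geometric_sum)
        show "(1/2::real)^n \<le> 1" by (simp add: power_le_one)
      qed (use C in \<open>auto intro!: sum_nonneg\<close>)
      finally show ?thesis by simp
    qed
    show "4 + 2 * t\<^sup>2 * C > 0" using C by (intro add_pos_nonneg) auto
  qed (use bh in auto)
qed

text \<open>An event on which the sequence is eventually positive does not influence the limit law of the sequence.
  If it had positive probability, the standard Gaussian would be a limit of laws on the positive
  half-line.\<close>

lemma (in prob_space) gaussian_infinitely_often_nonpos:
  fixes X :: "nat \<Rightarrow> 'a \<Rightarrow> real" and \<rho> :: "nat \<Rightarrow> nat \<Rightarrow> real"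
  assumes [measurable]: "\<And>n. X n \<in> borel_measurable M"
    and char1: "\<And>n t. (\<integral>x. iexp (t * X n x) \<partial>M) = of_real (exp (- t\<^sup>2 / 2))"
    and char2: "\<And>n m t. (\<integral>x. iexp (t * (X n x - X m x)) \<partial>M) = of_real (exp (- t\<^sup>2 * (1 - \<rho> n m)))"
    and rho1: "\<And>n m. \<bar>\<rho> n m\<bar> \<le> 1"
    and rho: "\<And>n m. n \<noteq> m \<Longrightarrow> \<bar>\<rho> n m\<bar> \<le> C * (1/2) ^ (n + m)"
  shows "AE x in M. \<exists>\<^sub>F n in sequentially. X n x \<le> 0"
proof -
  have "AE x in M. \<exists>n\<ge>k. X n x \<le> 0" for k
  proof -
    define A where "A = {x\<in>space M. \<forall>n\<ge>k. X n x > 0}"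
    have [measurable]: "A \<in> sets M" unfolding A_def by measurable
    have "prob A = 0"
    proof (rule ccontr)
      assume pA: "prob A \<noteq> 0"
      define U where "U = uniform_measure M A"
      have [measurable_cong, simp]: "sets U = sets M" by (simp add: U_def)
      interpret U: prob_space U unfolding U_def
        by (rule prob_space_uniform_measure) (use pA in \<open>auto simp: emeasure_eq_measure\<close>)
      define D where "D n = distr U borel (X n)" for n
      have rd: "real_distribution (D n)" for n unfolding D_def
        by (rule U.real_distribution_distr) simp
      have "(\<lambda>n. char (D n) t) \<longlonglongrightarrow> char std_normal_distribution t" for t
      proof -
        define \<mu> where "\<mu> = exp (- t\<^sup>2 / 2)"
        have 1: "(\<lambda>n. \<integral>x. of_real (indicat_real A x) * (iexp (t * X n x) - of_real \<mu>) \<partial>M) \<longlonglongrightarrow> 0"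
          unfolding \<mu>_def by (rule gaussian_weakly_mixing[OF assms(1) _ _ char1 char2 rho1 rho])
            (auto simp: indicator_def)
        have int: "integrable M (\<lambda>x. of_real (indicat_real A x) * iexp (t * X n x))" for n
          by (rule integrable_const_bound[where B=1]) (auto simp: norm_mult indicator_def)
        have int2: "integrable M (\<lambda>x. complex_of_real (indicat_real A x))"
          by (rule integrable_const_bound[where B=1]) (auto simp: norm_mult indicator_def)
        have 2: "(\<integral>x. of_real (indicat_real A x) * (iexp (t * X n x) - of_real \<mu>) \<partial>M)
           = (\<integral>x. of_real (indicat_real A x) * iexp (t * X n x) \<partial>M) - of_real (prob A * \<mu>)" for n
        proof -
          have "(\<integral>x. complex_of_real (indicat_real A x) \<partial>M) = of_real (prob A)"
            by (subst integral_complex_of_real) simp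
          then show ?thesis using int[of n] int2 by (simp add: algebra_simps)
        qed
        have 3: "char (D n) t = (\<integral>x. of_real (indicat_real A x) * iexp (t * X n x) \<partial>M) / of_real (prob A)" for n
        proof -
          have "char (D n) t = (\<integral>x. iexp (t * X n x) \<partial>U)"
            unfolding char_def D_def by (subst integral_distr) auto
          also have "U = density M (\<lambda>x. ennreal (indicat_real A x / prob A))"
            unfolding U_def uniform_measure_def
          proof (rule density_cong)
            have "indicator A x / emeasure M A = ennreal (indicat_real A x / prob A)" for x
              using pA divide_ennreal[of "indicat_real A x" "prob A"]
              by (simp add: emeasure_eq_measure ennreal_indicator zero_less_measure_iff)
            then show "AE x in M. indicator A x / emeasure M A = ennreal (indicat_real A x / prob A)"
              by simp
          qed auto
          also have "(\<integral>x. iexp (t * X n x) \<partial>density M (\<lambda>x. ennreal (indicat_real A x / prob A)))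
             = (\<integral>x. (indicat_real A x / prob A) *\<^sub>R iexp (t * X n x) \<partial>M)"
            by (rule integral_density) auto
          also have "\<dots> = (\<integral>x. of_real (indicat_real A x) * iexp (t * X n x) \<partial>M) / of_real (prob A)"
            by (subst integral_divide_zero[symmetric]) (simp add: scaleR_conv_of_real)
          finally show ?thesis .
        qed
        have "(\<lambda>n. ((\<integral>x. of_real (indicat_real A x) * (iexp (t * X n x) - of_real \<mu>) \<partial>M) + of_real (prob A * \<mu>)) / of_real (prob A))
           \<longlonglongrightarrow> (0 + of_real (prob A * \<mu>)) / of_real (prob A)"
          using pA by (intro tendsto_intros 1) auto
        then show ?thesis unfolding 2 3 char_std_normal_distribution \<mu>_def[symmetric] using pA by simp
      qed
      then have wc: "weak_conv_m D std_normal_distribution"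
        by (intro levy_continuity rd real_dist_normal_dist)
      \<comment> \<open>A bounded continuous function that detects the negative half-line.\<close>
      define f where "f x = max 0 (min 1 (-x))" for x :: real
      have [measurable]: "f \<in> borel_measurable borel" unfolding f_def by measurable
      have "continuous_on UNIV f" unfolding f_def by (intro continuous_intros)
      then have "isCont f x" for x by (simp add: continuous_on_eq_continuous_at)
      then have lim: "(\<lambda>n. integral\<^sup>L (D n) f) \<longlonglongrightarrow> integral\<^sup>L std_normal_distribution f"
        by (rule weak_conv_imp_integral_bdd_continuous_conv[OF rd real_dist_normal_dist wc, where B=1])
          (auto simp: f_def)
      have "eventually (\<lambda>n. integral\<^sup>L (D n) f = 0) sequentially"
        using eventually_ge_at_top[of k]
      proof eventually_elim
        case (elim n)
        have "AE x in U. f (X n x) = 0" unfolding U_def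
        proof (rule AE_uniform_measureI)
          have "f (X n x) = 0" if "x \<in> A" for x
          proof -
            have "0 < X n x" using that elim by (simp add: A_def)
            then show ?thesis by (simp add: f_def)
          qed
          then show "AE x in M. x \<in> A \<longrightarrow> f (X n x) = 0" by simp
        qed simp
        then have "(\<integral>x. f (X n x) \<partial>U) = 0" by (rule integral_eq_zero_AE)
        then show ?case unfolding D_def by (subst integral_distr) auto
      qed
      then have "(\<lambda>n. integral\<^sup>L (D n) f) \<longlonglongrightarrow> 0" by (rule tendsto_eventually)
      with lim have "integral\<^sup>L std_normal_distribution f = 0" by (rule LIMSEQ_unique)
      moreover interpret N: real_distribution std_normal_distribution by (rule real_dist_normal_dist)
      have "integrable std_normal_distribution f"
        by (rule N.integrable_const_bound[where B=1]) (auto simp: f_def)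
      ultimately have "AE x in std_normal_distribution. f x = 0"
        by (subst (asm) integral_nonneg_eq_0_iff_AE) (auto simp: f_def)
      then have "AE x in lborel. f x = 0"
        by (subst (asm) AE_density) (auto simp: std_normal_density_def)
      then have "AE x in lborel. x \<notin> {-1<..<(0::real)}"
        by eventually_elim (auto simp: f_def max_def min_def split: if_splits)
      then show False
        using AE_iff_measurable[of "{-1<..<0::real}" lborel "\<lambda>x. x \<notin> {-1<..<0}"]
        by (auto simp: set_eq_iff)
    qed
    then have "A \<in> null_sets M" by (simp add: emeasure_eq_measure null_setsI)
    then have "AE x in M. x \<notin> A" by (rule AE_not_in)
    then show ?thesis by (rule AE_mp) (auto simp: A_def not_less)
  qed
  then have "AE x in M. \<forall>k. \<exists>n\<ge>k. X n x \<le> 0" by (subst AE_all_countable) auto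
  then show ?thesis by (simp add: frequently_sequentially)
qed

section \<open>Closure properties of the Schwartz space\<close>

text \<open>A family of rapidly decreasing functions closed under differentiation consists of Schwartz functions.
  Iterated derivatives thus never have to be computed: each closure property below follows by naming a
  suitable family.\<close>

lemma schwartzI:
  assumes "X f"
    and der: "\<And>g. X g \<Longrightarrow> \<exists>g'. X g' \<and> (\<forall>x. (g has_vector_derivative g' x) (at x))"
    and bd: "\<And>g k. X g \<Longrightarrow> \<exists>C. \<forall>x. \<bar>x\<bar> ^ k * cmod (g x) \<le> C"
  shows "f \<in> schwartz"
proof -
  have X: "X (nth_vderiv n f)" for n
  proof (induction n)
    case (Suc n)
    then obtain g' where g': "X g'" "\<And>x. (nth_vderiv n f has_vector_derivative g' x) (at x)"
      using der by blast
    then have "nth_vderiv (Suc n) f = g'"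
      by (auto simp: nth_vderiv_def vector_derivative_at)
    then show ?case using g' by simp
  qed (simp add: nth_vderiv_def assms)
  show ?thesis unfolding schwartz_def
  proof safe
    fix n x show "nth_vderiv n f differentiable at x"
      using der[OF X[of n]] by (blast intro: differentiableI_vector)
  next
    fix k n
    obtain C where "\<forall>x. \<bar>x\<bar> ^ k * cmod (nth_vderiv n f x) \<le> C" using bd[OF X] by blast
    then show "bounded (range (\<lambda>x. x ^ k *\<^sub>R nth_vderiv n f x))"
      by (intro boundedI[of _ C]) (auto simp: power_abs)
  qed
qed

lemma nth_vderiv_0 [simp]: "nth_vderiv 0 f = f"
  by (simp add: nth_vderiv_def)

lemma nth_vderiv_Suc: "nth_vderiv (Suc n) f = nth_vderiv n (\<lambda>x. vector_derivative f (at x))"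
  unfolding nth_vderiv_def by (subst funpow_Suc_right) simp

lemma schwartz_derivE:
  assumes "f \<in> schwartz"
  obtains f' where "f' \<in> schwartz" "\<And>x. (f has_vector_derivative f' x) (at x)"
proof
  have d: "nth_vderiv n f differentiable at x" for n x using assms by (simp add: schwartz_def)
  show "(f has_vector_derivative vector_derivative f (at x)) (at x)" for x
    using d[of 0 x] by (simp add: vector_derivative_works)
  show "(\<lambda>x. vector_derivative f (at x)) \<in> schwartz"
    using assms unfolding schwartz_def by (auto simp flip: nth_vderiv_Suc)
qed

lemma schwartz_bound:
  assumes "f \<in> schwartz"
  obtains C where "\<And>x. \<bar>x\<bar> ^ k * cmod (f x) \<le> C"
proof -
  have "bounded (range (\<lambda>x. x ^ k *\<^sub>R nth_vderiv 0 f x))" using assms unfolding schwartz_def by blast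
  then show ?thesis using that by (auto simp: bounded_iff power_abs)
qed

lemma schwartz_linear:
  assumes "f \<in> schwartz" "bounded_linear T"
  shows "(\<lambda>x. T (f x)) \<in> schwartz"
proof (rule schwartzI[where X="\<lambda>h. \<exists>g\<in>schwartz. h = (\<lambda>x. T (g x))"])
  interpret bounded_linear T by fact
  fix h assume "\<exists>g\<in>schwartz. h = (\<lambda>x. T (g x))"
  then obtain g where g: "g \<in> schwartz" "h = (\<lambda>x. T (g x))" by blast
  obtain g' where g': "g' \<in> schwartz" "\<And>x. (g has_vector_derivative g' x) (at x)"
    using schwartz_derivE[OF g(1)] by blast
  show "\<exists>h'. (\<exists>g\<in>schwartz. h' = (\<lambda>x. T (g x))) \<and> (\<forall>x. (h has_vector_derivative h' x) (at x))"
    using g' has_vector_derivative[OF g'(2)] unfolding g(2) by blast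
  fix k
  obtain C where C: "\<And>x. \<bar>x\<bar> ^ k * cmod (g x) \<le> C" using schwartz_bound[OF g(1)] by blast
  obtain K where K: "K \<ge> 0" "\<And>x. cmod (T x) \<le> norm x * K" using nonneg_bounded by blast
  have "\<bar>x\<bar> ^ k * cmod (h x) \<le> C * K" for x
    using mult_left_mono[OF K(2)[of "g x"], of "\<bar>x\<bar>^k"] mult_right_mono[OF C[of x] K(1)]
    by (simp add: g(2) mult.assoc)
  then show "\<exists>C. \<forall>x. \<bar>x\<bar> ^ k * cmod (h x) \<le> C" by blast
qed (use assms in auto)

lemma schwartz_add:
  assumes "f \<in> schwartz" "g \<in> schwartz"
  shows "(\<lambda>x. f x + g x) \<in> schwartz"
proof (rule schwartzI[where X="\<lambda>h. \<exists>f\<in>schwartz. \<exists>g\<in>schwartz. h = (\<lambda>x. f x + g x)"])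
  fix h assume "\<exists>f\<in>schwartz. \<exists>g\<in>schwartz. h = (\<lambda>x. f x + g x)"
  then obtain f g where fg: "f \<in> schwartz" "g \<in> schwartz" "h = (\<lambda>x. f x + g x)" by blast
  obtain f' where f': "f' \<in> schwartz" "\<And>x. (f has_vector_derivative f' x) (at x)"
    using schwartz_derivE[OF fg(1)] by blast
  obtain g' where g': "g' \<in> schwartz" "\<And>x. (g has_vector_derivative g' x) (at x)"
    using schwartz_derivE[OF fg(2)] by blast
  show "\<exists>h'. (\<exists>f\<in>schwartz. \<exists>g\<in>schwartz. h' = (\<lambda>x. f x + g x)) \<and> (\<forall>x. (h has_vector_derivative h' x) (at x))"
    unfolding fg(3)
    by (rule exI[of _ "\<lambda>x. f' x + g' x"]) (use f' g' in \<open>auto intro: has_vector_derivative_add\<close>)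
  fix k
  obtain C where C: "\<And>x. \<bar>x\<bar> ^ k * cmod (f x) \<le> C" using schwartz_bound[OF fg(1)] by blast
  obtain D where D: "\<And>x. \<bar>x\<bar> ^ k * cmod (g x) \<le> D" using schwartz_bound[OF fg(2)] by blast
  have "\<bar>x\<bar> ^ k * cmod (h x) \<le> C + D" for x
    using mult_left_mono[OF norm_triangle_ineq[of "f x" "g x"], of "\<bar>x\<bar>^k"] C[of x] D[of x]
    by (simp add: fg(3) distrib_left)
  then show "\<exists>C. \<forall>x. \<bar>x\<bar> ^ k * cmod (h x) \<le> C" by blast
qed (use assms in auto)

lemma schwartz_affine:
  assumes "f \<in> schwartz" "a \<noteq> 0"
  shows "(\<lambda>x. f (a * x + b)) \<in> schwartz"
proof (rule schwartzI[where X="\<lambda>h. \<exists>g\<in>schwartz. h = (\<lambda>x. g (a * x + b))"])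
  fix h assume "\<exists>g\<in>schwartz. h = (\<lambda>x. g (a * x + b))"
  then obtain g where g: "g \<in> schwartz" "h = (\<lambda>x. g (a * x + b))" by blast
  obtain g' where g': "g' \<in> schwartz" "\<And>x. (g has_vector_derivative g' x) (at x)"
    using schwartz_derivE[OF g(1)] by blast
  have "(h has_vector_derivative a *\<^sub>R g' (a * x + b)) (at x)" for x
  proof -
    have "((\<lambda>x. a * x + b) has_vector_derivative a) (at x)"
      by (auto intro!: derivative_eq_intros simp flip: has_real_derivative_iff_has_vector_derivative)
    from vector_diff_chain_at[OF this g'(2)] show ?thesis by (simp add: g(2) o_def)
  qed
  moreover have "(\<lambda>x. a *\<^sub>R g' x) \<in> schwartz"
    using schwartz_linear[OF g'(1) bounded_linear_scaleR_right] .
  ultimately show "\<exists>h'. (\<exists>g\<in>schwartz. h' = (\<lambda>x. g (a * x + b))) \<and> (\<forall>x. (h has_vector_derivative h' x) (at x))"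
    by (intro exI[of _ "\<lambda>x. a *\<^sub>R g' (a * x + b)"]) (auto intro!: bexI[of _ "\<lambda>x. a *\<^sub>R g' x"])
  fix k
  obtain C where C: "\<And>x. \<bar>x\<bar> ^ k * cmod (g x) \<le> C" using schwartz_bound[OF g(1)] by blast
  obtain D where D: "\<And>x. \<bar>x\<bar> ^ 0 * cmod (g x) \<le> D" using schwartz_bound[OF g(1)] by blast
  have "\<bar>x\<bar> ^ k * cmod (h x) \<le> (2 / \<bar>a\<bar>) ^ k * (C + \<bar>b\<bar> ^ k * D)" for x
  proof -
    define y where "y = a * x + b"
    have "x = (y - b) / a" using assms by (simp add: y_def)
    then have "\<bar>x\<bar> = \<bar>y - b\<bar> / \<bar>a\<bar>" by (simp add: abs_divide)
    also have "\<dots> \<le> (2 / \<bar>a\<bar>) * max \<bar>y\<bar> \<bar>b\<bar>" using assms by (simp add: divide_right_mono)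
    finally have "\<bar>x\<bar> ^ k \<le> ((2 / \<bar>a\<bar>) * max \<bar>y\<bar> \<bar>b\<bar>) ^ k" by (intro power_mono) auto
    also have "\<dots> \<le> (2 / \<bar>a\<bar>) ^ k * (\<bar>y\<bar> ^ k + \<bar>b\<bar> ^ k)"
      unfolding power_mult_distrib by (intro mult_left_mono) (auto simp: max_def)
    finally have "\<bar>x\<bar> ^ k * cmod (g y) \<le> (2 / \<bar>a\<bar>) ^ k * (\<bar>y\<bar> ^ k + \<bar>b\<bar> ^ k) * cmod (g y)"
      by (rule mult_right_mono) simp
    also have "\<dots> = (2 / \<bar>a\<bar>) ^ k * (\<bar>y\<bar> ^ k * cmod (g y) + \<bar>b\<bar> ^ k * cmod (g y))"
      by (simp add: algebra_simps)
    also have "\<dots> \<le> (2 / \<bar>a\<bar>) ^ k * (C + \<bar>b\<bar> ^ k * D)"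
      by (intro mult_left_mono add_mono) (use C[of y] D[of y] in auto)
    finally show ?thesis by (simp add: g(2) y_def)
  qed
  then show "\<exists>C. \<forall>x. \<bar>x\<bar> ^ k * cmod (h x) \<le> C" by blast
qed (use assms in auto)

lemma schwartz_continuous: "f \<in> schwartz \<Longrightarrow> continuous_on UNIV f"
  by (erule schwartz_derivE) (auto simp: continuous_on_eq_continuous_at intro: has_vector_derivative_continuous)

lemma schwartz_measurable: "f \<in> schwartz \<Longrightarrow> f \<in> borel_measurable lborel"
  by (simp add: borel_measurable_continuous_onI schwartz_continuous)

lemma schwartz_integrable:
  assumes "f \<in> schwartz"
  shows "integrable lborel (\<lambda>x. x ^ k *\<^sub>R f x)"
proof -
  obtain C where C: "\<And>x. \<bar>x\<bar> ^ k * cmod (f x) \<le> C" using schwartz_bound[OF assms] by blast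
  obtain D where D: "\<And>x. \<bar>x\<bar> ^ (k + 2) * cmod (f x) \<le> D" using schwartz_bound[OF assms] by blast
  have m: "f \<in> borel_measurable lborel" using assms by (rule schwartz_measurable)
  have "integrable lborel (\<lambda>x. (C + D) * inverse (1 + x\<^sup>2))"
    using integrable_inverse_1_plus_square by (simp add: set_integrable_def)
  then show ?thesis
  proof (rule Bochner_Integration.integrable_bound)
    show "AE x in lborel. norm (x ^ k *\<^sub>R f x) \<le> norm ((C + D) * inverse (1 + x\<^sup>2))"
    proof (rule AE_I2)
      fix x
      have "\<bar>x\<bar> ^ k * cmod (f x) * (1 + x\<^sup>2) \<le> C + D"
        using C[of x] D[of x] by (simp add: algebra_simps power_add power2_eq_square)
      moreover have "1 + x\<^sup>2 > 0" by (simp add: add_pos_nonneg)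
      ultimately have "\<bar>x\<bar> ^ k * cmod (f x) \<le> (C + D) * inverse (1 + x\<^sup>2)"
        by (simp add: field_simps)
      also have "\<dots> \<le> norm ((C + D) * inverse (1 + x\<^sup>2))" by simp
      finally show "norm (x ^ k *\<^sub>R f x) \<le> norm ((C + D) * inverse (1 + x\<^sup>2))"
        by (simp add: power_abs)
    qed
  qed (use m in measurable)
qed

lemma schwartz_mult_id:
  assumes "f \<in> schwartz"
  shows "(\<lambda>x. of_real x * f x) \<in> schwartz"
proof (rule schwartzI[where X="\<lambda>h. \<exists>f\<in>schwartz. \<exists>g\<in>schwartz. h = (\<lambda>x. of_real x * f x + g x)"])
  show "\<exists>g\<in>schwartz. \<exists>e\<in>schwartz. (\<lambda>x. of_real x * f x) = (\<lambda>x. of_real x * g x + e x)"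
    using assms schwartz_linear[OF assms bounded_linear_zero] by (intro bexI[of _ f] bexI[of _ "\<lambda>x. 0"]) auto
next
  fix h assume "\<exists>f\<in>schwartz. \<exists>g\<in>schwartz. h = (\<lambda>x. of_real x * f x + g x)"
  then obtain f g where fg: "f \<in> schwartz" "g \<in> schwartz" "h = (\<lambda>x. of_real x * f x + g x)" by blast
  obtain f' where f': "f' \<in> schwartz" "\<And>x. (f has_vector_derivative f' x) (at x)"
    using schwartz_derivE[OF fg(1)] by blast
  obtain g' where g': "g' \<in> schwartz" "\<And>x. (g has_vector_derivative g' x) (at x)"
    using schwartz_derivE[OF fg(2)] by blast
  have "(h has_vector_derivative of_real x * f' x + (f x + g' x)) (at x)" for x
    unfolding fg(3) by (auto intro!: derivative_eq_intros f' g' simp: algebra_simps)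
  moreover have "(\<lambda>x. f x + g' x) \<in> schwartz" using fg g' by (intro schwartz_add)
  ultimately show "\<exists>h'. (\<exists>f\<in>schwartz. \<exists>g\<in>schwartz. h' = (\<lambda>x. of_real x * f x + g x)) \<and>
      (\<forall>x. (h has_vector_derivative h' x) (at x))"
    using f'(1) by (intro exI[of _ "\<lambda>x. of_real x * f' x + (f x + g' x)"] conjI
      bexI[of _ "\<lambda>x. f x + g' x"] bexI[of _ f']) auto
  fix k
  obtain C where C: "\<And>x. \<bar>x\<bar> ^ Suc k * cmod (f x) \<le> C" using schwartz_bound[OF fg(1)] by blast
  obtain D where D: "\<And>x. \<bar>x\<bar> ^ k * cmod (g x) \<le> D" using schwartz_bound[OF fg(2)] by blast
  have "\<bar>x\<bar> ^ k * cmod (h x) \<le> C + D" for x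
    using mult_left_mono[OF norm_triangle_ineq[of "of_real x * f x" "g x"], of "\<bar>x\<bar>^k"] C[of x] D[of x]
    by (simp add: fg(3) distrib_left norm_mult mult_ac)
  then show "\<exists>C. \<forall>x. \<bar>x\<bar> ^ k * cmod (h x) \<le> C" by blast
qed

lemma schwartz_cmult: "f \<in> schwartz \<Longrightarrow> (\<lambda>x. c * f x) \<in> schwartz"
  by (rule schwartz_linear[OF _ bounded_linear_mult_right])

lemma schwartz_Re: "f \<in> schwartz \<Longrightarrow> (\<lambda>x. of_real (Re (f x))) \<in> schwartz"
  by (rule schwartz_linear[where T="\<lambda>z. of_real (Re z)"])
    (auto intro: bounded_linear_compose[OF bounded_linear_of_real bounded_linear_Re])

lemma schwartz_Im: "f \<in> schwartz \<Longrightarrow> (\<lambda>x. of_real (Im (f x))) \<in> schwartz"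
  by (rule schwartz_linear[where T="\<lambda>z. of_real (Im z)"])
    (auto intro: bounded_linear_compose[OF bounded_linear_of_real bounded_linear_Im])

lemma schwartz_wavelet:
  assumes "f \<in> schwartz" "a > 0" shows "wavelet f a b \<in> schwartz"
proof -
  have "wavelet f a b = (\<lambda>x. of_real (1 / sqrt a) * f ((1 / a) * x + (- b / a)))"
    by (simp add: wavelet_def fun_eq_iff scaleR_conv_of_real diff_divide_distrib)
  also have "\<dots> \<in> schwartz"
    by (rule schwartz_cmult, rule schwartz_affine[OF assms(1)]) (use assms(2) in simp)
  finally show ?thesis .
qed

section \<open>Test functions supported in an interval\<close>

text \<open>Smooth functions vanishing outside \<open>[l, u]\<close>. Being coinductive, the definition yields smoothness
  from a single differentiation step.\<close>

coinductive test_fun :: "real \<Rightarrow> real \<Rightarrow> (real \<Rightarrow> complex) \<Rightarrow> bool" for l u where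
  test_funI: "\<lbrakk>\<forall>x. x \<notin> {l..u} \<longrightarrow> f x = 0; \<forall>x. (f has_vector_derivative f' x) (at x); test_fun l u f'\<rbrakk>
    \<Longrightarrow> test_fun l u f"

lemma test_fun_zero: "test_fun l u f \<Longrightarrow> x \<notin> {l..u} \<Longrightarrow> f x = 0"
  by (erule test_fun.cases) auto

lemma test_fun_derivE:
  assumes "test_fun l u f"
  obtains f' where "test_fun l u f'" "\<And>x. (f has_vector_derivative f' x) (at x)"
  using assms by (cases rule: test_fun.cases) auto

lemma test_fun_coinduct:
  assumes "X f"
    and "\<And>h. X h \<Longrightarrow> (\<forall>x. x \<notin> {l..u} \<longrightarrow> h x = 0) \<and> (\<exists>h'. X h' \<and> (\<forall>x. (h has_vector_derivative h' x) (at x)))"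
  shows "test_fun l u f"
  using assms(1) by (rule test_fun.coinduct) (use assms(2) in blast)

lemma test_fun_continuous: "test_fun l u f \<Longrightarrow> continuous_on S f"
  by (erule test_fun_derivE)
    (auto intro!: continuous_at_imp_continuous_on has_vector_derivative_continuous)

lemma test_fun_schwartz:
  assumes "test_fun l u f" shows "f \<in> schwartz"
proof (rule schwartzI[where X="test_fun l u", OF assms])
  fix g k assume g: "test_fun l u g"
  have "compact ((\<lambda>x. \<bar>x\<bar> ^ k * cmod (g x)) ` {l..u})"
    by (intro compact_continuous_image continuous_intros test_fun_continuous[OF g]) auto
  then obtain C where C: "\<forall>x\<in>{l..u}. \<bar>x\<bar> ^ k * cmod (g x) \<le> C"
    by (auto dest!: compact_imp_bounded simp: bounded_iff)
  have "\<bar>x\<bar> ^ k * cmod (g x) \<le> max 0 C" for x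
    using C test_fun_zero[OF g, of x] by (cases "x \<in> {l..u}") (auto simp: le_max_iff_disj)
  then show "\<exists>C. \<forall>x. \<bar>x\<bar> ^ k * cmod (g x) \<le> C" by blast
qed (blast elim: test_fun_derivE)

lemma test_fun_flat0:
  assumes "test_fun l u f" "0 \<notin> {l..u}" shows "f \<in> schwartz_flat0"
proof -
  have "test_fun l u (nth_vderiv n f)" for n
  proof (induction n)
    case (Suc n)
    then obtain g' where g': "test_fun l u g'" "\<And>x. (nth_vderiv n f has_vector_derivative g' x) (at x)"
      by (blast elim: test_fun_derivE)
    then have "nth_vderiv (Suc n) f = g'"
      by (auto simp: nth_vderiv_def vector_derivative_at)
    then show ?case using g' by simp
  qed (simp add: assms)
  from test_fun_zero[OF this assms(2)] show ?thesis using test_fun_schwartz[OF assms(1)]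
    by (auto simp: schwartz_flat0_def)
qed

text \<open>The sums of products that arise from \<open>g * f\<close> by repeated use of the product rule.\<close>

inductive product_sum :: "(real \<Rightarrow> complex) set \<Rightarrow> real \<Rightarrow> real \<Rightarrow> (real \<Rightarrow> complex) \<Rightarrow> bool" for G l u where
  "\<lbrakk>g \<in> G; test_fun l u f\<rbrakk> \<Longrightarrow> product_sum G l u (\<lambda>x. g x * f x)"
| "\<lbrakk>product_sum G l u h; product_sum G l u k\<rbrakk> \<Longrightarrow> product_sum G l u (\<lambda>x. h x + k x)"

text \<open>The multiplier needs to be smooth only near the support, which admits the power functions on the
  negative half-line, singular at the origin.\<close>

lemma test_fun_mult:
  assumes "test_fun l u f" "g \<in> G" and U: "open U" "{l..u} \<subseteq> U"
    and G: "\<And>g. g \<in> G \<Longrightarrow> \<exists>g'\<in>G. \<forall>x\<in>U. (g has_vector_derivative g' x) (at x)"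
  shows "test_fun l u (\<lambda>x. g x * f x)"
proof (rule test_fun_coinduct[where X="product_sum G l u"])
  show "product_sum G l u (\<lambda>x. g x * f x)" using assms by (intro product_sum.intros)
  fix h assume "product_sum G l u h"
  then show "(\<forall>x. x \<notin> {l..u} \<longrightarrow> h x = 0) \<and> (\<exists>h'. product_sum G l u h' \<and> (\<forall>x. (h has_vector_derivative h' x) (at x)))"
  proof induction
    case (1 g f)
    obtain g' where g': "g' \<in> G" "\<And>x. x \<in> U \<Longrightarrow> (g has_vector_derivative g' x) (at x)" using G 1(1) by blast
    obtain f' where f': "test_fun l u f'" "\<And>x. (f has_vector_derivative f' x) (at x)"
      using 1(2) by (blast elim: test_fun_derivE)
    have "((\<lambda>x. g x * f x) has_vector_derivative g x * f' x + g' x * f x) (at x)" for x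
    proof (cases "x \<in> U")
      case True
      then show ?thesis using has_vector_derivative_mult[OF g'(2) f'(2)] by simp
    next
      case False
      then have x: "x \<in> - {l..u}" using U(2) by auto
      have "((\<lambda>x. g x * f x) has_vector_derivative 0) (at x)"
        by (rule has_vector_derivative_transform_within_open[OF has_vector_derivative_const[of 0], where S="- {l..u}"])
          (use x test_fun_zero[OF 1(2)] in auto)
      then show ?thesis using x test_fun_zero[OF 1(2)] test_fun_zero[OF f'(1)] by simp
    qed
    moreover have "product_sum G l u (\<lambda>x. g x * f' x + g' x * f x)"
      by (intro product_sum.intros 1 g' f')
    ultimately show ?case using test_fun_zero[OF 1(2)] by auto
  next
    case (2 h k)
    then obtain h' k' where "product_sum G l u h'" "\<And>x. (h has_vector_derivative h' x) (at x)"
      "product_sum G l u k'" "\<And>x. (k has_vector_derivative k' x) (at x)" by blast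
    then have "product_sum G l u (\<lambda>x. h' x + k' x)"
      "\<forall>x. ((\<lambda>x. h x + k x) has_vector_derivative h' x + k' x) (at x)"
      by (auto intro: product_sum.intros has_vector_derivative_add)
    then show ?case using 2 by auto
  qed
qed

lemma test_fun_scale:
  assumes "test_fun l u f" "a > 0"
  shows "test_fun (l / a) (u / a) (\<lambda>x. f (a * x))"
proof (rule test_fun_coinduct[where X="\<lambda>h. \<exists>c f. test_fun l u f \<and> h = (\<lambda>x. c * f (a * x))"])
  show "\<exists>c g. test_fun l u g \<and> (\<lambda>x. f (a * x)) = (\<lambda>x. c * g (a * x))"
    using assms by (intro exI[of _ 1] exI[of _ f]) auto
  fix h assume "\<exists>c f. test_fun l u f \<and> h = (\<lambda>x. c * f (a * x))"
  then obtain c f where f: "test_fun l u f" "h = (\<lambda>x. c * f (a * x))" by blast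
  obtain f' where f': "test_fun l u f'" "\<And>x. (f has_vector_derivative f' x) (at x)"
    using f(1) by (blast elim: test_fun_derivE)
  have "(h has_vector_derivative (c * a) * f' (a * x)) (at x)" for x
  proof -
    have "((\<lambda>x. a * x) has_vector_derivative a) (at x)"
      by (auto intro!: derivative_eq_intros simp flip: has_real_derivative_iff_has_vector_derivative)
    from vector_diff_chain_at[OF this f'(2)]
    have "((\<lambda>x. f (a * x)) has_vector_derivative a *\<^sub>R f' (a * x)) (at x)" by (simp add: o_def)
    from has_vector_derivative_mult_right[OF this, of c] show ?thesis
      by (simp add: f(2) scaleR_conv_of_real mult.assoc)
  qed
  moreover have "h x = 0" if "x \<notin> {l / a..u / a}" for x
  proof -
    have "a * x \<notin> {l..u}" using that assms(2) by (auto simp: field_simps)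
    then show ?thesis using test_fun_zero[OF f(1)] by (simp add: f(2))
  qed
  ultimately show "(\<forall>x. x \<notin> {l / a..u / a} \<longrightarrow> h x = 0) \<and>
      (\<exists>h'. (\<exists>c f. test_fun l u f \<and> h' = (\<lambda>x. c * f (a * x))) \<and> (\<forall>x. (h has_vector_derivative h' x) (at x)))"
    using f'(1) by (intro conjI exI[of _ "\<lambda>x. (c * a) * f' (a * x)"]) blast+
qed

lemma test_fun_mult_exp:
  assumes "test_fun l u f"
  shows "test_fun l u (\<lambda>x. c * exp (\<i> * of_real (b * x)) * f x)"
proof (rule test_fun_mult[where U=UNIV and G="{\<lambda>x. c * exp (\<i> * of_real (b * x)) | c. True}", OF assms])
  fix g assume "g \<in> {\<lambda>x. c * exp (\<i> * of_real (b * x)) | c. True}"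
  then obtain c where g: "g = (\<lambda>x. c * exp (\<i> * of_real (b * x)))" by blast
  have "(g has_vector_derivative (c * \<i> * b) * exp (\<i> * of_real (b * x))) (at x)" for x
  proof -
    have "((\<lambda>z. c * exp (\<i> * (of_real b * z))) has_field_derivative
        (c * \<i> * b) * exp (\<i> * (of_real b * of_real x))) (at (of_real x))"
      by (auto intro!: derivative_eq_intros)
    from has_vector_derivative_real_field[OF this] show ?thesis unfolding g by simp
  qed
  then show "\<exists>g'\<in>{\<lambda>x. c * exp (\<i> * of_real (b * x)) | c. True}. \<forall>x\<in>UNIV. (g has_vector_derivative g' x) (at x)"
    by (intro bexI[of _ "\<lambda>x. (c * \<i> * b) * exp (\<i> * of_real (b * x))"]) auto
qed auto

lemma test_fun_mult_power:
  assumes "test_fun l u f"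
  shows "test_fun l u (\<lambda>x. (c * of_real x ^ k) * f x)"
proof (rule test_fun_mult[where U=UNIV and G="{\<lambda>x. c * of_real x ^ k | c k. True}", OF assms])
  fix g :: "real \<Rightarrow> complex" assume "g \<in> {\<lambda>x. c * of_real x ^ k | c k. True}"
  then obtain c k where g: "g = (\<lambda>x. c * of_real x ^ k)" by blast
  have "(g has_vector_derivative (c * of_nat k) * of_real x ^ (k - 1)) (at x)" for x
  proof -
    have "((\<lambda>z. c * z ^ k) has_field_derivative (c * of_nat k) * of_real x ^ (k - 1)) (at (of_real x))"
      by (auto intro!: derivative_eq_intros)
    from has_vector_derivative_real_field[OF this] show ?thesis unfolding g by simp
  qed
  then show "\<exists>g'\<in>{\<lambda>x. c * of_real x ^ k | c k. True}. \<forall>x\<in>UNIV. (g has_vector_derivative g' x) (at x)"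
    by (intro bexI[of _ "\<lambda>x. (c * of_nat k) * of_real x ^ (k - 1)"]) auto
qed auto

lemma test_fun_mult_powr:
  assumes "test_fun l u f" "u < 0"
  shows "test_fun l u (\<lambda>x. (c * of_real ((- x) powr p)) * f x)"
proof (rule test_fun_mult[where U="{..<0}" and G="{\<lambda>x. c * of_real ((- x) powr p) | c p. True}", OF assms(1)])
  fix g :: "real \<Rightarrow> complex" assume "g \<in> {\<lambda>x. c * of_real ((- x) powr p) | c p. True}"
  then obtain c p where g: "g = (\<lambda>x. c * of_real ((- x) powr p))" by blast
  have der: "(g has_vector_derivative (- c * p) * of_real ((- x) powr (p - 1))) (at x)" if "x < 0" for x
  proof -
    have "((\<lambda>x. (- x) powr p) has_real_derivative - p * (- x) powr (p - 1)) (at x)"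
      using that by (auto intro!: derivative_eq_intros simp: powr_diff field_simps)
    then have "((\<lambda>x. complex_of_real ((- x) powr p)) has_vector_derivative of_real (- p * (- x) powr (p - 1))) (at x)"
      by (intro has_vector_derivative_of_real)
    from has_vector_derivative_mult_right[OF this, of c] show ?thesis unfolding g by (simp add: mult_ac)
  qed
  then show "\<exists>g'\<in>{\<lambda>x. c * of_real ((- x) powr p) | c p. True}. \<forall>x\<in>{..<0}. (g has_vector_derivative g' x) (at x)"
    by (intro bexI[of _ "\<lambda>x. (- c * p) * of_real ((- x) powr (p - 1))"]) (use der in simp, blast)
qed (use assms in auto)

section \<open>The Fourier transform of Schwartz and test functions\<close>

lemma fourier_integrable:
  assumes "integrable lborel f"
  shows "integrable lborel (\<lambda>x. exp (- \<i> * of_real w * of_real x) * f x)"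
proof (rule Bochner_Integration.integrable_bound[OF assms])
  show "AE x in lborel. norm (exp (- \<i> * of_real w * of_real x) * f x) \<le> norm (f x)"
    by (simp add: norm_mult)
qed (use assms[THEN borel_measurable_integrable] in measurable)

text \<open>The second-order Taylor bound for \<open>exp (\<i> * y)\<close> controls the difference quotient directly by
  \<open>\<bar>h\<bar> / 2\<close> times the second absolute moment of \<open>f\<close>.\<close>

lemma fourier_has_vector_derivative:
  assumes f: "f \<in> schwartz"
  shows "(fourier f has_vector_derivative fourier (\<lambda>x. - \<i> * (of_real x * f x)) w) (at w)"
proof -
  define I where "I = (\<integral>x. x\<^sup>2 * cmod (f x) \<partial>lborel)"
  have i2: "integrable lborel (\<lambda>x. x\<^sup>2 * cmod (f x))"
    using integrable_norm[OF schwartz_integrable[OF f, of 2]] by simp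
  have if0: "integrable lborel f" using schwartz_integrable[OF f, of 0] by simp
  have if1: "integrable lborel (\<lambda>x. - \<i> * (of_real x * f x))"
    using schwartz_integrable[OF f, of 1] by (simp add: scaleR_conv_of_real)
  have lin: "(\<integral>x. A x - B x - h *\<^sub>R C x \<partial>lborel)
      = (\<integral>x. A x \<partial>lborel) - (\<integral>x. B x \<partial>lborel) - h *\<^sub>R (\<integral>x. C x \<partial>lborel)"
    if "integrable lborel A" "integrable lborel B" "integrable lborel C" for h and A B C :: "real \<Rightarrow> complex"
    using that by simp
  have bound: "cmod (fourier f (w + h) - fourier f w - h *\<^sub>R fourier (\<lambda>x. - \<i> * (of_real x * f x)) w) \<le> h\<^sup>2 / 2 * I" for h
  proof -
    have "fourier f (w + h) - fourier f w - h *\<^sub>R fourier (\<lambda>x. - \<i> * (of_real x * f x)) w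
      = (\<integral>x. exp (- \<i> * of_real (w + h) * of_real x) * f x - exp (- \<i> * of_real w * of_real x) * f x
          - h *\<^sub>R (exp (- \<i> * of_real w * of_real x) * (- \<i> * (of_real x * f x))) \<partial>lborel)"
      unfolding fourier_def by (rule lin[symmetric]; rule fourier_integrable; rule if0 if1)
    also have "cmod \<dots> \<le> (\<integral>x. h\<^sup>2 / 2 * (x\<^sup>2 * cmod (f x)) \<partial>lborel)"
    proof (rule Bochner_Integration.integral_norm_bound_integral)
      fix x :: real
      have "exp (- \<i> * of_real (w + h) * of_real x) * f x - exp (- \<i> * of_real w * of_real x) * f x
          - h *\<^sub>R (exp (- \<i> * of_real w * of_real x) * (- \<i> * (of_real x * f x)))
        = exp (\<i> * of_real (- w * x)) * (iexp (- h * x) - (1 + \<i> * of_real (- h * x))) * f x"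
        by (simp add: algebra_simps exp_add exp_diff exp_minus scaleR_conv_of_real divide_inverse)
      also have "cmod \<dots> = cmod (iexp (- h * x) - (\<Sum>k\<le>1. (\<i> * of_real (- h * x)) ^ k / fact k)) * cmod (f x)"
        by (simp only: norm_mult norm_exp_i_times) simp
      also have "\<dots> \<le> (\<bar>- h * x\<bar> ^ Suc 1 / fact (Suc 1)) * cmod (f x)"
        by (rule mult_right_mono[OF iexp_approx1]) simp
      also have "\<dots> = h\<^sup>2 / 2 * (x\<^sup>2 * cmod (f x))"
        by (simp only: Suc_1 power2_abs) (simp add: power_mult_distrib fact_numeral)
      finally show "cmod (exp (- \<i> * of_real (w + h) * of_real x) * f x - exp (- \<i> * of_real w * of_real x) * f x
          - h *\<^sub>R (exp (- \<i> * of_real w * of_real x) * (- \<i> * (of_real x * f x)))) \<le> h\<^sup>2 / 2 * (x\<^sup>2 * cmod (f x))" .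
    qed (intro Bochner_Integration.integrable_diff integrable_scaleR_right fourier_integrable if0 if1 integrable_mult_right i2)+
    also have "\<dots> = h\<^sup>2 / 2 * I" unfolding I_def by simp
    finally show ?thesis .
  qed
  have "((\<lambda>h. norm (fourier f (w + h) - fourier f w - h *\<^sub>R fourier (\<lambda>x. - \<i> * (of_real x * f x)) w) / norm h) \<longlongrightarrow> 0) (at 0)"
  proof (rule Lim_null_comparison[where g="\<lambda>h. \<bar>h\<bar> / 2 * I"])
    show "\<forall>\<^sub>F h in at 0. norm (norm (fourier f (w + h) - fourier f w - h *\<^sub>R fourier (\<lambda>x. - \<i> * (of_real x * f x)) w) / norm h) \<le> \<bar>h\<bar> / 2 * I"
      using bound by (auto simp: eventually_at_filter divide_simps power2_eq_square abs_mult_self_eq mult_ac intro!: always_eventually)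
    show "((\<lambda>h. \<bar>h\<bar> / 2 * I) \<longlongrightarrow> 0) (at 0)" by (auto intro!: tendsto_eq_intros)
  qed
  then show ?thesis
    unfolding has_vector_derivative_def has_derivative_at by (auto intro: bounded_linear_scaleR_left)
qed

lemma test_fun_fourier:
  assumes "f \<in> schwartz" "\<And>w. w \<notin> {l..u} \<Longrightarrow> fourier f w = 0"
  shows "test_fun l u (fourier f)"
proof (rule test_fun_coinduct[where X="\<lambda>h. (\<exists>g\<in>schwartz. h = fourier g) \<and> (\<forall>x. x \<notin> {l..u} \<longrightarrow> h x = 0)"])
  show "(\<exists>g\<in>schwartz. fourier f = fourier g) \<and> (\<forall>x. x \<notin> {l..u} \<longrightarrow> fourier f x = 0)" using assms by blast
  fix h assume h: "(\<exists>g\<in>schwartz. h = fourier g) \<and> (\<forall>x. x \<notin> {l..u} \<longrightarrow> h x = 0)"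
  then obtain g where g: "g \<in> schwartz" "h = fourier g" by blast
  define g' where "g' = (\<lambda>x. - \<i> * (of_real x * g x))"
  have g': "g' \<in> schwartz" unfolding g'_def
    by (rule schwartz_linear[OF schwartz_mult_id[OF g(1)] bounded_linear_mult_right])
  have der: "(h has_vector_derivative fourier g' x) (at x)" for x
    unfolding g'_def g(2) by (rule fourier_has_vector_derivative[OF g(1)])
  have "fourier g' x = 0" if x: "x \<notin> {l..u}" for x
  proof -
    have "(h has_vector_derivative 0) (at x)"
      by (rule has_vector_derivative_transform_within_open[OF has_vector_derivative_const[of 0], where S="- {l..u}"])
        (use x h in auto)
    then show ?thesis using der vector_derivative_unique_at by blast
  qed
  then show "(\<forall>x. x \<notin> {l..u} \<longrightarrow> h x = 0) \<and> (\<exists>h'. ((\<exists>g\<in>schwartz. h' = fourier g) \<and> (\<forall>x. x \<notin> {l..u} \<longrightarrow> h' x = 0)) \<and>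
      (\<forall>x. (h has_vector_derivative h' x) (at x)))"
    using h g' der by blast
qed

lemma test_fun_integral_deriv:
  assumes f: "test_fun l u f" and der: "\<And>x. (f has_vector_derivative f' x) (at x)"
    and f': "continuous_on UNIV f'" "\<And>x. x \<notin> {l..u} \<Longrightarrow> f' x = 0"
  shows "(\<integral>x. f' x \<partial>lborel) = 0"
proof -
  \<comment> \<open>Both endpoints lie outside the support, also if \<open>l > u\<close>.\<close>
  define a b where "a = min l u - 1" and "b = max l u + 1"
  have "(\<integral>x. f' x \<partial>lborel) = (\<integral>x. indicator {a..b} x *\<^sub>R f' x \<partial>lborel)"
  proof (intro Bochner_Integration.integral_cong refl)
    fix x show "f' x = indicator {a..b} x *\<^sub>R f' x"
    proof (cases "x \<in> {a..b}")
      case False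
      then have "x \<notin> {l..u}" by (auto simp: a_def b_def)
      with False show ?thesis using f'(2)[of x] by simp
    qed simp
  qed
  also have "\<dots> = f b - f a"
    by (rule integral_FTC_Icc)
      (use der f'(1) in \<open>auto simp: a_def b_def intro: has_vector_derivative_at_within continuous_on_subset\<close>)
  also have "\<dots> = 0"
  proof -
    have "a \<notin> {l..u}" "b \<notin> {l..u}" by (auto simp: a_def b_def)
    then show ?thesis using test_fun_zero[OF f] by simp
  qed
  finally show ?thesis .
qed

text \<open>Integration by parts: the derivative of \<open>exp (- \<i> * w * x) * f x\<close> has integral \<open>0\<close>.\<close>

lemma fourier_deriv:
  assumes f: "test_fun l u f" and f': "test_fun l u f'" "\<And>x. (f has_vector_derivative f' x) (at x)"
  shows "fourier f' w = \<i> * of_real w * fourier f w"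
proof -
  define e where "e x = exp (- \<i> * of_real w * of_real x)" for x :: real
  have e: "(e has_vector_derivative - \<i> * of_real w * e x) (at x)" for x
  proof -
    have "((\<lambda>z. exp (- \<i> * of_real w * z)) has_field_derivative
        - \<i> * of_real w * exp (- \<i> * of_real w * of_real x)) (at (of_real x))"
      by (auto intro!: derivative_eq_intros)
    from has_vector_derivative_real_field[OF this] show ?thesis unfolding e_def .
  qed
  have t: "test_fun l u (\<lambda>x. e x * f x)"
    using test_fun_mult_exp[OF f, of 1 "-w"] by (simp add: e_def mult.assoc)
  have if0: "integrable lborel f" using schwartz_integrable[OF test_fun_schwartz[OF f], of 0] by simp
  have if1: "integrable lborel f'" using schwartz_integrable[OF test_fun_schwartz[OF f'(1)], of 0] by simp
  have "0 = (\<integral>x. e x * f' x - \<i> * of_real w * (e x * f x) \<partial>lborel)"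
  proof (rule test_fun_integral_deriv[OF t, symmetric])
    show "((\<lambda>x. e x * f x) has_vector_derivative e x * f' x - \<i> * of_real w * (e x * f x)) (at x)" for x
      using has_vector_derivative_mult[OF e f'(2)] by (simp add: algebra_simps)
    show "continuous_on UNIV (\<lambda>x. e x * f' x - \<i> * of_real w * (e x * f x))"
      unfolding e_def by (intro continuous_intros test_fun_continuous[OF f] test_fun_continuous[OF f'(1)])
  qed (use test_fun_zero[OF f] test_fun_zero[OF f'(1)] in auto)
  also have "\<dots> = fourier f' w - \<i> * of_real w * fourier f w"
    unfolding fourier_def e_def using fourier_integrable[OF if0, of w] fourier_integrable[OF if1, of w]
    by (simp only: Bochner_Integration.integral_diff integrable_mult_right integral_mult_right_zero)
  finally show ?thesis by simp
qed

lemma power_fourier_test_fun: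
  assumes "test_fun l u f"
  shows "\<exists>g. test_fun l u g \<and> (\<forall>w. of_real w ^ k * fourier f w = fourier g w)"
proof (induction k)
  case 0 then show ?case using assms by auto
next
  case (Suc k)
  then obtain g where g: "test_fun l u g" "\<And>w. of_real w ^ k * fourier f w = fourier g w" by blast
  obtain g' where g': "test_fun l u g'" "\<And>x. (g has_vector_derivative g' x) (at x)"
    using test_fun_derivE[OF g(1)] by blast
  have "of_real w ^ Suc k * fourier f w = fourier (\<lambda>x. - \<i> * g' x) w" for w
  proof -
    have "fourier (\<lambda>x. - \<i> * g' x) w = - \<i> * fourier g' w"
      unfolding fourier_def by (simp flip: integral_mult_right_zero) (simp add: mult_ac)
    also have "\<dots> = of_real w * fourier g w" unfolding fourier_deriv[OF g(1) g'] by (simp add: mult.assoc[symmetric])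
    finally show ?thesis by (simp add: g(2)[symmetric] mult_ac)
  qed
  moreover have "test_fun l u (\<lambda>x. - \<i> * g' x)" using test_fun_mult_power[OF g'(1), of "-\<i>" 0] by simp
  ultimately show ?case by blast
qed

lemma norm_fourier_le: "cmod (fourier f w) \<le> (\<integral>x. cmod (f x) \<partial>lborel)"
proof -
  have "cmod (fourier f w) \<le> (\<integral>x. cmod (exp (- \<i> * of_real w * of_real x) * f x) \<partial>lborel)"
    unfolding fourier_def by (rule integral_norm_bound)
  then show ?thesis by (simp add: norm_mult)
qed

lemma fourier_test_fun_schwartz:
  assumes "test_fun l u f" shows "fourier f \<in> schwartz"
proof (rule schwartzI[where X="\<lambda>h. \<exists>g. test_fun l u g \<and> h = fourier g"])
  fix h assume "\<exists>g. test_fun l u g \<and> h = fourier g"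
  then obtain g where g: "test_fun l u g" "h = fourier g" by blast
  have "test_fun l u (\<lambda>x. - \<i> * (of_real x * g x))"
    using test_fun_mult_power[OF g(1), of "-\<i>" 1] by (simp add: mult.assoc)
  then show "\<exists>h'. (\<exists>g. test_fun l u g \<and> h' = fourier g) \<and> (\<forall>x. (h has_vector_derivative h' x) (at x))"
    using fourier_has_vector_derivative[OF test_fun_schwartz[OF g(1)]] g(2) by blast
  fix k
  obtain g2 where g2: "\<And>w. of_real w ^ k * fourier g w = fourier g2 w"
    using power_fourier_test_fun[OF g(1)] by blast
  have "\<bar>w\<bar> ^ k * cmod (h w) = cmod (of_real w ^ k * fourier g w)" for w
    by (simp add: g(2) norm_mult norm_power)
  then have "\<bar>w\<bar> ^ k * cmod (h w) \<le> (\<integral>x. cmod (g2 x) \<partial>lborel)" for w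
    unfolding g2 using norm_fourier_le[of g2 w] by simp
  then show "\<exists>C. \<forall>x. \<bar>x\<bar> ^ k * cmod (h x) \<le> C" by blast
qed (use assms in blast)

text \<open>Gaussian regularisation. Inserting a wide Gaussian into the inversion integral and exchanging the
  integrals turns it into the mean of \<open>f\<close> under a narrow Gaussian centred at \<open>x\<close>, since the Gaussian is
  its own Fourier transform. Both sides converge by dominated convergence as the width grows.\<close>

lemma fourier_inversion:
  assumes f: "f \<in> schwartz" and F: "fourier f \<in> schwartz"
  shows "inv_fourier (fourier f) x = f x"
proof -
  let ?N = std_normal_distribution
  interpret N: real_distribution ?N by (rule real_dist_normal_dist)
  have if0: "integrable lborel f" using schwartz_integrable[OF f, of 0] by simp
  have iF: "integrable lborel (fourier f)" using schwartz_integrable[OF F, of 0] by simp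
  have [measurable]: "f \<in> borel_measurable borel" "fourier f \<in> borel_measurable borel"
    using schwartz_measurable f F by auto
  obtain C where C: "\<And>y. cmod (f y) \<le> C" using schwartz_bound[OF f, of 0] by auto
  define J where "J = (\<integral>w. exp (\<i> * of_real w * of_real x) * fourier f w \<partial>lborel)"
  have N_lborel: "(\<integral>z. g z \<partial>?N) = (\<integral>z. std_normal_density z *\<^sub>R g z \<partial>lborel)"
    if "g \<in> borel_measurable borel" for g :: "real \<Rightarrow> complex"
    using that by (subst integral_density) auto
  \<comment> \<open>Fubini's theorem for the standard normal distribution and Lebesgue measure, after substituting \<open>w = m * z\<close>.\<close>
  have eq: "(\<integral>w. std_normal_density (w / real (Suc n)) *\<^sub>R (exp (\<i> * of_real w * of_real x) * fourier f w) \<partial>lborel)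
      = sqrt (2 * pi) *\<^sub>R (\<integral>z. f (x + z / real (Suc n)) \<partial>?N)" for n
  proof -
    define m where "m = real (Suc n)"
    have m: "m > 0" by (simp add: m_def)
    interpret P: pair_sigma_finite ?N lborel ..
    have "(\<integral>w. std_normal_density (w / m) *\<^sub>R (exp (\<i> * of_real w * of_real x) * fourier f w) \<partial>lborel)
       = m *\<^sub>R (\<integral>z. std_normal_density z *\<^sub>R (exp (\<i> * of_real (m * z) * of_real x) * fourier f (m * z)) \<partial>lborel)"
      by (subst lborel_integral_real_affine[where c=m and t=0]) (use m in auto)
    also have "(\<integral>z. std_normal_density z *\<^sub>R (exp (\<i> * of_real (m * z) * of_real x) * fourier f (m * z)) \<partial>lborel)
       = (\<integral>z. exp (\<i> * of_real (m * z) * of_real x) * fourier f (m * z) \<partial>?N)"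
      by (subst N_lborel) auto
    also have "\<dots> = (\<integral>z. (\<integral>y. iexp (m * (x - y) * z) * f y \<partial>lborel) \<partial>?N)"
    proof -
      have "exp (\<i> * of_real (m * z) * of_real x) * (exp (- \<i> * of_real (m * z) * of_real y) * f y)
          = iexp (m * (x - y) * z) * f y" for y z
      proof -
        have "\<i> * of_real (m * z) * of_real x + - \<i> * of_real (m * z) * of_real y = \<i> * of_real (m * (x - y) * z)"
          by (simp add: algebra_simps)
        then show ?thesis by (simp only: mult.assoc[symmetric] exp_add[symmetric])
      qed
      then show ?thesis unfolding fourier_def by (simp only: integral_mult_right_zero[symmetric])
    qed
    also have "\<dots> = (\<integral>y. (\<integral>z. iexp (m * (x - y) * z) * f y \<partial>?N) \<partial>lborel)"
    proof (rule P.Fubini_integral[symmetric])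
      show "integrable (?N \<Otimes>\<^sub>M lborel) (\<lambda>(z, y). iexp (m * (x - y) * z) * f y)"
      proof (rule P.Fubini_integrable)
        have "integrable lborel (\<lambda>y. iexp (m * (x - y) * z) * f y)" for z
          by (rule Bochner_Integration.integrable_bound[OF if0]) (auto simp: norm_mult)
        then show "AE z in ?N. integrable lborel (\<lambda>y. case (z, y) of (z, y) \<Rightarrow> iexp (m * (x - y) * z) * f y)"
          by simp
      qed (auto simp: norm_mult)
    qed
    also have "\<dots> = (\<integral>y. of_real (exp (- (m * (x - y))\<^sup>2 / 2)) * f y \<partial>lborel)"
    proof -
      have "(\<integral>z. iexp (m * (x - y) * z) * f y \<partial>?N) = of_real (exp (- (m * (x - y))\<^sup>2 / 2)) * f y" for y
        using fun_cong[OF char_std_normal_distribution, of "m * (x - y)"] unfolding char_def by simp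
      then show ?thesis by (simp only:)
    qed
    also have "\<dots> = (1 / m) *\<^sub>R (\<integral>z. of_real (exp (- z\<^sup>2 / 2)) * f (x + z / m) \<partial>lborel)"
      by (subst lborel_integral_real_affine[where c="1/m" and t=x]) (use m in auto)
    also have "m *\<^sub>R \<dots> = (\<integral>z. of_real (exp (- z\<^sup>2 / 2)) * f (x + z / m) \<partial>lborel)" using m by simp
    also have "\<dots> = (\<integral>z. sqrt (2 * pi) *\<^sub>R (std_normal_density z *\<^sub>R f (x + z / m)) \<partial>lborel)"
      by (intro Bochner_Integration.integral_cong refl) (simp add: std_normal_density_def scaleR_conv_of_real)
    also have "\<dots> = sqrt (2 * pi) *\<^sub>R (\<integral>z. std_normal_density z *\<^sub>R f (x + z / m) \<partial>lborel)"
      by (simp only: integral_scaleR_right)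
    also have "(\<integral>z. std_normal_density z *\<^sub>R f (x + z / m) \<partial>lborel) = (\<integral>z. f (x + z / m) \<partial>?N)"
      by (rule N_lborel[symmetric]) measurable
    finally show ?thesis unfolding m_def .
  qed
  have lim0: "(\<lambda>n. z / real (Suc n)) \<longlonglongrightarrow> 0" for z :: real
    by (rule LIMSEQ_Suc[OF lim_const_over_n])
  have cn: "isCont (\<lambda>z. std_normal_density z) 0"
    unfolding std_normal_density_def by (auto intro!: continuous_intros)
  have cf: "isCont f y" for y using schwartz_continuous[OF f] by (simp add: continuous_on_eq_continuous_at)
  have lim1: "(\<lambda>n. \<integral>w. std_normal_density (w / real (Suc n)) *\<^sub>R (exp (\<i> * of_real w * of_real x) * fourier f w) \<partial>lborel)
     \<longlonglongrightarrow> (\<integral>w. std_normal_density 0 *\<^sub>R (exp (\<i> * of_real w * of_real x) * fourier f w) \<partial>lborel)"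
  proof (rule integral_dominated_convergence[where w="\<lambda>w. std_normal_density 0 * cmod (fourier f w)"])
    show "AE w in lborel. (\<lambda>n. std_normal_density (w / real (Suc n)) *\<^sub>R (exp (\<i> * of_real w * of_real x) * fourier f w))
        \<longlonglongrightarrow> std_normal_density 0 *\<^sub>R (exp (\<i> * of_real w * of_real x) * fourier f w)"
    proof (intro AE_I2 tendsto_intros)
      fix w show "(\<lambda>n. std_normal_density (w / real (Suc n))) \<longlonglongrightarrow> std_normal_density 0"
        by (rule isCont_tendsto_compose[OF cn lim0])
    qed
    show "AE w in lborel. norm (std_normal_density (w / real (Suc n)) *\<^sub>R (exp (\<i> * of_real w * of_real x) * fourier f w))
        \<le> std_normal_density 0 * cmod (fourier f w)" for n
      by (auto simp: norm_mult std_normal_density_def intro!: divide_right_mono mult_left_le_one_le)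
  qed (use iF in auto)
  have lim2: "(\<lambda>n. \<integral>z. f (x + z / real (Suc n)) \<partial>?N) \<longlonglongrightarrow> (\<integral>z. f x \<partial>?N)"
  proof (rule integral_dominated_convergence[where w="\<lambda>_. C"])
    show "AE z in ?N. (\<lambda>n. f (x + z / real (Suc n))) \<longlonglongrightarrow> f x"
    proof (intro AE_I2 isCont_tendsto_compose[OF cf])
      fix z show "(\<lambda>n. x + z / real (Suc n)) \<longlonglongrightarrow> x" using tendsto_add[OF tendsto_const lim0] by simp
    qed
  qed (use C in auto)
  have "(\<integral>w. std_normal_density 0 *\<^sub>R (exp (\<i> * of_real w * of_real x) * fourier f w) \<partial>lborel)
     = sqrt (2 * pi) *\<^sub>R (\<integral>z. f x \<partial>?N)"
    using lim1 tendsto_scaleR[OF tendsto_const lim2, of "sqrt (2 * pi)"] unfolding eq by (rule LIMSEQ_unique)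
  then have "(1 / sqrt (2 * pi)) *\<^sub>R J = sqrt (2 * pi) *\<^sub>R f x"
    using N.prob_space by (simp add: J_def std_normal_density_def)
  then have "sqrt (2 * pi) *\<^sub>R ((1 / sqrt (2 * pi)) *\<^sub>R J) = (sqrt (2 * pi) * sqrt (2 * pi)) *\<^sub>R f x" by simp
  then have "J = of_real (2 * pi) * f x" by (simp add: scaleR_conv_of_real)
  then show ?thesis unfolding inv_fourier_def J_def by simp
qed

lemma fourier_inv_fourier:
  assumes f: "f \<in> schwartz" and F: "fourier f \<in> schwartz"
  shows "fourier (inv_fourier f) = f"
proof
  fix x
  have inv: "inv_fourier f w = (1 / (2 * pi)) * fourier f (- w)" for w
    unfolding inv_fourier_def fourier_def by (simp add: mult_ac)
  have "fourier (inv_fourier f) x = (\<integral>w. exp (- \<i> * of_real w * of_real x) * ((1 / (2 * pi)) * fourier f (- w)) \<partial>lborel)"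
    unfolding fourier_def[of "inv_fourier f"] inv by (simp add: mult_ac)
  also have "\<dots> = (\<integral>w. (1 / (2 * pi)) * (exp (\<i> * of_real w * of_real x) * fourier f w) \<partial>lborel)"
    by (subst lborel_integral_real_affine[where c="-1" and t=0]) (simp_all add: mult_ac)
  also have "\<dots> = inv_fourier (fourier f) x"
    unfolding inv_fourier_def by (subst integral_mult_right_zero) simp
  also have "\<dots> = f x" by (rule fourier_inversion[OF assms])
  finally show "fourier (inv_fourier f) x = f x" .
qed

text \<open>The \<open>n\<close>-th moment of \<open>fourier f\<close> is the integral of the transform of a multiple of the \<open>n\<close>-th
  derivative of \<open>f\<close>, which by inversion is a multiple of that derivative at the origin.\<close>

lemma fourier_test_fun_moment0:
  assumes "test_fun l u f" "0 \<notin> {l..u}" shows "fourier f \<in> schwartz_moment0"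
proof -
  have "(\<integral>x. x ^ n *\<^sub>R fourier f x \<partial>lborel) = 0" for n
  proof -
    obtain g where g: "test_fun l u g" "\<And>w. of_real w ^ n * fourier f w = fourier g w"
      using power_fourier_test_fun[OF assms(1)] by blast
    have "0 = inv_fourier (fourier g) 0"
      using fourier_inversion[OF test_fun_schwartz[OF g(1)] fourier_test_fun_schwartz[OF g(1)], of 0]
        test_fun_zero[OF g(1) assms(2)] by simp
    then have "(\<integral>x. fourier g x \<partial>lborel) = 0" by (simp add: inv_fourier_def)
    then show ?thesis by (simp add: scaleR_conv_of_real g(2))
  qed
  then show ?thesis using fourier_test_fun_schwartz[OF assms(1)] by (simp add: schwartz_moment0_def)
qed

lemma inv_fourier_fourier_test_fun:
  "test_fun l u f \<Longrightarrow> inv_fourier (fourier f) = f"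
  using fourier_inversion test_fun_schwartz fourier_test_fun_schwartz by blast

section \<open>Wavelets and the fractional multiplier\<close>

lemma wavelet_fourier:
  assumes "a > 0"
  shows "wavelet (fourier h) a b = fourier (\<lambda>w. of_real (sqrt a) * exp (\<i> * of_real (b * w)) * h (a * w))"
proof
  fix x
  have "fourier (\<lambda>w. of_real (sqrt a) * exp (\<i> * of_real (b * w)) * h (a * w)) x
      = (\<integral>w. of_real (sqrt a) * (exp (\<i> * of_real (- w * (x - b))) * h (a * w)) \<partial>lborel)"
    unfolding fourier_def
    by (intro Bochner_Integration.integral_cong refl) (simp add: algebra_simps exp_diff exp_minus exp_add divide_inverse)
  also have "\<dots> = of_real (sqrt a) * (\<integral>w. exp (\<i> * of_real (- w * (x - b))) * h (a * w) \<partial>lborel)"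
    by (rule integral_mult_right_zero)
  also have "(\<integral>w. exp (\<i> * of_real (- w * (x - b))) * h (a * w) \<partial>lborel)
      = (1 / a) *\<^sub>R (\<integral>w. exp (\<i> * of_real (- (w / a) * (x - b))) * h w \<partial>lborel)"
    by (subst lborel_integral_real_affine[where c="1/a" and t=0]) (use assms in auto)
  also have "(\<integral>w. exp (\<i> * of_real (- (w / a) * (x - b))) * h w \<partial>lborel) = fourier h ((x - b) / a)"
    unfolding fourier_def by (intro Bochner_Integration.integral_cong refl) (simp add: mult_ac)
  also have "of_real (sqrt a) * ((1 / a) *\<^sub>R fourier h ((x - b) / a)) = wavelet (fourier h) a b x"
  proof -
    have "sqrt a * (1 / a) = 1 / sqrt a"
      using assms real_sqrt_mult_self[of a] by (simp add: field_simps del: real_sqrt_mult_self)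
    then show ?thesis by (simp only: wavelet_def scaleR_conv_of_real mult.assoc[symmetric] of_real_mult[symmetric])
  qed
  finally show "wavelet (fourier h) a b x = fourier (\<lambda>w. of_real (sqrt a) * exp (\<i> * of_real (b * w)) * h (a * w)) x" by simp
qed

lemma test_fun_modulate_scale:
  assumes "test_fun l u f" "a > 0"
  shows "test_fun (l / a) (u / a) (\<lambda>w. c * exp (\<i> * of_real (b * w)) * f (a * w))"
  by (rule test_fun_mult_exp[OF test_fun_scale[OF assms]])

lemma frac_multiplier_neg:
  "w < 0 \<Longrightarrow> frac_multiplier \<gamma> w = of_real ((- w) powr \<gamma>) * exp (- \<i> * \<gamma> * (pi / 2))"
  by (simp add: frac_multiplier_def scaleR_conv_of_real)

text \<open>The Fourier transform of a distribution acts by transposition and without reflection, so the relevant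
  function is the inverse transform of \<open>\<kappa>\<close>; it is supported on the negative half-line.\<close>

lemma signature_wavelet_fourier_rep:
  assumes "signature_wavelet \<kappa>"
  obtains l u \<psi> where "test_fun l u \<psi>" "u < 0" "\<kappa> = fourier \<psi>"
proof -
  from assms obtain c d where cd: "0 < c" "closure {\<omega>. fourier \<kappa> \<omega> \<noteq> 0} \<subseteq> {c..d}" and k: "\<kappa> \<in> schwartz"
    unfolding signature_wavelet_def by blast
  have z: "fourier \<kappa> w = 0" if "w \<notin> {c..d}" for w
    using that cd(2) closure_subset[of "{\<omega>. fourier \<kappa> \<omega> \<noteq> 0}"] by blast
  \<comment> \<open>The inverse transform of \<open>\<kappa>\<close>, written as a Fourier transform.\<close>
  define \<kappa>' where "\<kappa>' = (\<lambda>x. (1 / (2 * pi)) *\<^sub>R \<kappa> (- 1 * x + 0))"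
  have k': "\<kappa>' \<in> schwartz" unfolding \<kappa>'_def
    by (intro schwartz_linear[OF schwartz_affine[OF k] bounded_linear_scaleR_right]) simp
  have eq: "inv_fourier \<kappa> w = (1 / (2 * pi)) * fourier \<kappa> (- w)" for w
    unfolding inv_fourier_def fourier_def by (simp add: mult_ac)
  have eq2: "inv_fourier \<kappa> w = fourier \<kappa>' w" for w
  proof -
    have "fourier \<kappa>' w = (\<integral>x. exp (\<i> * of_real w * of_real x) * ((1 / (2 * pi)) *\<^sub>R \<kappa> x) \<partial>lborel)"
      unfolding fourier_def \<kappa>'_def by (subst lborel_integral_real_affine[where c="-1" and t=0]) simp_all
    also have "\<dots> = (\<integral>x. (1 / (2 * pi)) *\<^sub>R (exp (\<i> * of_real x * of_real w) * \<kappa> x) \<partial>lborel)"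
      by (simp add: mult_ac)
    also have "\<dots> = (1 / (2 * pi)) *\<^sub>R (\<integral>x. exp (\<i> * of_real x * of_real w) * \<kappa> x \<partial>lborel)"
      by (rule integral_scaleR_right)
    finally show ?thesis unfolding inv_fourier_def by (simp add: scaleR_conv_of_real)
  qed
  have t: "test_fun (- d) (- c) (inv_fourier \<kappa>)"
    unfolding eq2[abs_def]
    by (rule test_fun_fourier[OF k']) (unfold eq2[symmetric] eq, use z in auto)
  have "fourier \<kappa> \<in> schwartz" by (rule test_fun_schwartz[OF test_fun_fourier[OF k z]])
  then have "\<kappa> = fourier (inv_fourier \<kappa>)" using fourier_inv_fourier[OF k] by simp
  then show ?thesis using that[OF t] cd(1) by simp
qed

text \<open>With \<open>\<kappa> = fourier \<psi>\<close>, take for \<open>\<theta>\<close> the transform of \<open>\<psi>\<close> divided by the multiplier. Dilation, translation and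
  multiplication keep supports away from the origin, so all functions occurring lie in the
  spaces on which \<open>frac_D\<close> acts.\<close>

lemma fractional_integral_wavelet:
  assumes "signature_wavelet \<kappa>"
  obtains \<theta> where "\<theta> \<in> schwartz"
    "\<And>f g a b. \<lbrakk>f \<in> tempered_mod_poly; frac_D \<gamma> f = mod_poly g; a > 0\<rbrakk>
       \<Longrightarrow> f (wavelet \<kappa> a b) = of_real (a powr \<gamma>) * g (wavelet \<theta> a b)"
proof -
  obtain l u \<psi> where psi: "test_fun l u \<psi>" and u: "u < 0" and k: "\<kappa> = fourier \<psi>"
    using signature_wavelet_fourier_rep[OF assms] by blast
  define \<eta> where "\<eta> = (\<lambda>w. (exp (\<i> * \<gamma> * (pi / 2)) * of_real ((- w) powr (- \<gamma>))) * \<psi> w)"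
  have eta: "test_fun l u \<eta>" unfolding \<eta>_def by (rule test_fun_mult_powr[OF psi u])
  have m_eta: "frac_multiplier \<gamma> w * \<eta> w = \<psi> w" for w
  proof (cases "w < 0")
    case True
    then have "(- w) powr \<gamma> * (- w) powr (- \<gamma>) = 1" by (simp flip: powr_add)
    then have "complex_of_real ((- w) powr \<gamma>) * of_real ((- w) powr (- \<gamma>)) = 1"
      unfolding of_real_mult[symmetric] by simp
    moreover have "exp (- \<i> * \<gamma> * (pi / 2)) * exp (\<i> * \<gamma> * (pi / 2)) = 1"
      by (simp flip: exp_add)
    moreover have "frac_multiplier \<gamma> w * \<eta> w = (complex_of_real ((- w) powr \<gamma>) * of_real ((- w) powr (- \<gamma>)))
       * (exp (- \<i> * \<gamma> * (pi / 2)) * exp (\<i> * \<gamma> * (pi / 2))) * \<psi> w"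
      unfolding frac_multiplier_neg[OF True] \<eta>_def by (simp only: mult_ac)
    ultimately show ?thesis by simp
  next
    case False
    then show ?thesis using test_fun_zero[OF psi, of w] u by (simp add: \<eta>_def)
  qed
  have m_scale: "frac_multiplier \<gamma> w = of_real (a powr (- \<gamma>)) * frac_multiplier \<gamma> (a * w)" if "a > 0" for a w
  proof -
    have "\<bar>w\<bar> powr \<gamma> = a powr (- \<gamma>) * \<bar>a * w\<bar> powr \<gamma>"
      using that by (simp add: abs_mult powr_mult mult.assoc[symmetric] flip: powr_add)
    moreover have "sgn (a * w) = sgn w" using that by (simp add: sgn_mult)
    ultimately show ?thesis by (simp add: frac_multiplier_def scaleR_conv_of_real)
  qed
  show ?thesis
  proof
    show "fourier \<eta> \<in> schwartz" by (rule fourier_test_fun_schwartz[OF eta])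
    fix f g a b assume f: "f \<in> tempered_mod_poly" and D: "frac_D \<gamma> f = mod_poly g" and a: "(a::real) > 0"
    define S where "S h = (\<lambda>w. of_real (sqrt a) * exp (\<i> * of_real (b * w)) * h (a * w))" for h :: "real \<Rightarrow> complex"
    have t_eta: "test_fun (l / a) (u / a) (S \<eta>)" and t_psi: "test_fun (l / a) (u / a) (S \<psi>)"
      unfolding S_def by (intro test_fun_modulate_scale eta psi a)+
    have w_eta: "wavelet (fourier \<eta>) a b = fourier (S \<eta>)" and w_psi: "wavelet \<kappa> a b = fourier (S \<psi>)"
      unfolding S_def k by (rule wavelet_fourier[OF a])+
    have n0: "0 \<notin> {l / a..u / a}" using divide_neg_pos[OF u a] by auto
    have mS: "(\<lambda>w. frac_multiplier \<gamma> w * S \<eta> w) = (\<lambda>w. (of_real (a powr (- \<gamma>)) * of_real w ^ 0) * S \<psi> w)"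
    proof
      fix w
      show "frac_multiplier \<gamma> w * S \<eta> w = (of_real (a powr (- \<gamma>)) * of_real w ^ 0) * S \<psi> w"
        unfolding S_def m_scale[OF a, of w] m_eta[of "a * w", symmetric] by (simp add: mult_ac)
    qed
    have tm: "test_fun (l / a) (u / a) (\<lambda>w. frac_multiplier \<gamma> w * S \<eta> w)"
      unfolding mS by (rule test_fun_mult_power[OF t_psi])
    have mom: "fourier (S \<eta>) \<in> schwartz_moment0" "fourier (S \<psi>) \<in> schwartz_moment0"
      by (intro fourier_test_fun_moment0[OF _ n0] t_eta t_psi)+
    have "g (fourier (S \<eta>)) = frac_D \<gamma> f (fourier (S \<eta>))"
      using mom unfolding D mod_poly_def by simp
    also have "\<dots> = f (fourier (\<lambda>w. frac_multiplier \<gamma> w * S \<eta> w))"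
      using mom test_fun_flat0[OF t_eta n0] test_fun_flat0[OF tm n0]
      unfolding frac_D_def inv_fourier_dist_def mult_dist_def fourier_dist_def
      by (simp add: inv_fourier_fourier_test_fun[OF t_eta])
    also have "fourier (\<lambda>w. frac_multiplier \<gamma> w * S \<eta> w) = (\<lambda>x. of_real (a powr (- \<gamma>)) * fourier (S \<psi>) x)"
    proof
      fix x
      have "fourier (\<lambda>w. frac_multiplier \<gamma> w * S \<eta> w) x
        = (\<integral>w. of_real (a powr (- \<gamma>)) * (exp (- \<i> * of_real x * of_real w) * S \<psi> w) \<partial>lborel)"
        unfolding mS fourier_def by (simp add: mult_ac)
      also have "\<dots> = of_real (a powr (- \<gamma>)) * fourier (S \<psi>) x"
        unfolding fourier_def by (rule integral_mult_right_zero)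
      finally show "fourier (\<lambda>w. frac_multiplier \<gamma> w * S \<eta> w) x = of_real (a powr (- \<gamma>)) * fourier (S \<psi>) x" .
    qed
    also have "f \<dots> = of_real (a powr (- \<gamma>)) * f (fourier (S \<psi>))"
      using f mom(2) unfolding tempered_mod_poly_def dual_of_def by blast
    finally have "of_real (a powr \<gamma>) * g (fourier (S \<eta>))
        = of_real (a powr \<gamma> * a powr (- \<gamma>)) * f (fourier (S \<psi>))"
      by (simp add: mult.assoc)
    also have "a powr \<gamma> * a powr (- \<gamma>) = 1" using a by (simp flip: powr_add)
    finally show "f (wavelet \<kappa> a b) = of_real (a powr \<gamma>) * g (wavelet (fourier \<eta>) a b)"
      unfolding w_eta w_psi by simp
  qed
qed
section \<open>White noise on dilates of a Schwartz function\<close>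

lemma measurable_evaluation:
  assumes "w \<in> M \<rightarrow>\<^sub>M cylinder_space V F" "\<phi> \<in> V"
  shows "(\<lambda>\<xi>. w \<xi> \<phi>) \<in> borel_measurable M"
proof -
  have "(\<lambda>f. f \<phi>) \<in> cylinder_space V F \<rightarrow>\<^sub>M borel" unfolding cylinder_space_def
    by (rule measurable_restrict_space1[OF measurable_component_singleton[OF assms(2)]])
  from measurable_compose[OF assms(1) this] show ?thesis .
qed

lemma white_noise_values:
  assumes "gaussian_white_noise M s w" "\<xi> \<in> space M"
  shows white_noise_add: "\<phi> \<in> schwartz \<Longrightarrow> \<psi> \<in> schwartz \<Longrightarrow> w \<xi> (\<lambda>x. \<phi> x + \<psi> x) = w \<xi> \<phi> + w \<xi> \<psi>"
    and white_noise_scale: "\<phi> \<in> schwartz \<Longrightarrow> w \<xi> (\<lambda>x. c * \<phi> x) = c * w \<xi> \<phi>"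
    and white_noise_real: "\<phi> \<in> schwartz \<Longrightarrow> range \<phi> \<subseteq> \<real> \<Longrightarrow> w \<xi> \<phi> \<in> \<real>"
proof -
  have "w \<xi> \<in> space (cylinder_space schwartz real_tempered)"
    using assms measurable_space unfolding gaussian_white_noise_def by metis
  then have "w \<xi> \<in> real_tempered" by (simp add: cylinder_space_def space_restrict_space)
  then show "\<phi> \<in> schwartz \<Longrightarrow> \<psi> \<in> schwartz \<Longrightarrow> w \<xi> (\<lambda>x. \<phi> x + \<psi> x) = w \<xi> \<phi> + w \<xi> \<psi>"
    and "\<phi> \<in> schwartz \<Longrightarrow> w \<xi> (\<lambda>x. c * \<phi> x) = c * w \<xi> \<phi>"
    and "\<phi> \<in> schwartz \<Longrightarrow> range \<phi> \<subseteq> \<real> \<Longrightarrow> w \<xi> \<phi> \<in> \<real>"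
    unfolding real_tempered_def tempered_def dual_of_def by blast+
qed

lemma white_noise_Re:
  assumes wn: "gaussian_white_noise M s w" "\<xi> \<in> space M" and f: "f \<in> schwartz"
  shows "Re (w \<xi> f) = Re (w \<xi> (\<lambda>x. of_real (Re (f x))))"
proof -
  have "f = (\<lambda>x. of_real (Re (f x)) + \<i> * of_real (Im (f x)))" by (rule ext) (rule complex_eq)
  then have "w \<xi> f = w \<xi> (\<lambda>x. of_real (Re (f x)) + \<i> * of_real (Im (f x)))" by simp
  also have "\<dots> = w \<xi> (\<lambda>x. of_real (Re (f x))) + \<i> * w \<xi> (\<lambda>x. of_real (Im (f x)))"
    using white_noise_add[OF wn schwartz_Re[OF f] schwartz_cmult[OF schwartz_Im[OF f]]]
      white_noise_scale[OF wn schwartz_Im[OF f]] by simp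
  finally have "w \<xi> f = w \<xi> (\<lambda>x. of_real (Re (f x))) + \<i> * w \<xi> (\<lambda>x. of_real (Im (f x)))" .
  moreover have "w \<xi> (\<lambda>x. of_real (Im (f x))) \<in> \<real>"
    by (rule white_noise_real[OF wn schwartz_Im[OF f]]) auto
  ultimately show ?thesis by (auto elim!: Reals_cases)
qed

lemma white_noise_char:
  fixes p :: "real \<Rightarrow> real"
  assumes wn: "gaussian_white_noise M s w" and p: "(\<lambda>x. complex_of_real (p x)) \<in> schwartz"
  shows "(\<integral>\<xi>. iexp (t * Re (w \<xi> (\<lambda>x. of_real (p x)))) \<partial>M) = of_real (exp (- (s\<^sup>2 / 2) * t\<^sup>2 * (\<integral>x. (p x)\<^sup>2 \<partial>lborel)))"
proof -
  define q where "q = (\<lambda>x. complex_of_real t * of_real (p x))"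
  have q: "q \<in> schwartz" unfolding q_def by (rule schwartz_cmult[OF p])
  have m: "w \<in> M \<rightarrow>\<^sub>M cylinder_space schwartz real_tempered" using wn by (simp add: gaussian_white_noise_def)
  have "(\<integral>\<xi>. iexp (t * Re (w \<xi> (\<lambda>x. of_real (p x)))) \<partial>M) = (\<integral>\<xi>. exp (\<i> * w \<xi> q) \<partial>M)"
  proof (rule Bochner_Integration.integral_cong[OF refl])
    fix \<xi> assume xi: "\<xi> \<in> space M"
    have "w \<xi> (\<lambda>x. of_real (p x)) \<in> \<real>" by (rule white_noise_real[OF wn xi p]) auto
    then have "w \<xi> q = of_real (t * Re (w \<xi> (\<lambda>x. of_real (p x))))"
      unfolding q_def white_noise_scale[OF wn xi p] by (simp add: of_real_Re)
    then show "iexp (t * Re (w \<xi> (\<lambda>x. of_real (p x)))) = exp (\<i> * w \<xi> q)" by simp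
  qed
  also have "\<dots> = (\<integral>f. exp (\<i> * f q) \<partial>(distr M (cylinder_space schwartz real_tempered) w))"
  proof (rule integral_distr[OF m, symmetric])
    have [measurable]: "(\<lambda>f. f q) \<in> borel_measurable (cylinder_space schwartz real_tempered)"
      by (rule measurable_evaluation[where w="\<lambda>f. f" and F=real_tempered, OF _ q]) simp
    show "(\<lambda>f. exp (\<i> * f q)) \<in> borel_measurable (cylinder_space schwartz real_tempered)"
      by measurable
  qed
  also have "\<dots> = exp (- (s\<^sup>2 / 2) * (\<integral>x. (cmod (q x))\<^sup>2 \<partial>lborel))"
    using wn q unfolding gaussian_white_noise_def q_def by (auto simp: Reals_mult)
  also have "(\<integral>x. (cmod (q x))\<^sup>2 \<partial>lborel) = t\<^sup>2 * (\<integral>x. (p x)\<^sup>2 \<partial>lborel)"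
    unfolding q_def by (simp add: norm_mult power_mult_distrib)
  finally show ?thesis by (simp add: exp_of_real mult.assoc)
qed

definition dilate :: "(real \<Rightarrow> real) \<Rightarrow> real \<Rightarrow> real \<Rightarrow> real \<Rightarrow> real" where
  "dilate p b a x = p ((x - b) / a) / sqrt a"

lemma integral_dilate:
  fixes g :: "real \<Rightarrow> real"
  assumes "a > 0"
  shows "(\<integral>x. g ((x - b) / a) \<partial>lborel) = a * (\<integral>x. g x \<partial>lborel)"
  by (subst lborel_integral_real_affine[where c=a and t=b]) (use assms in auto)

lemma integrable_dilate:
  fixes g :: "real \<Rightarrow> real"
  assumes "a > 0" "integrable lborel g"
  shows "integrable lborel (\<lambda>x. g ((x - b) / a))"
  using lborel_integrable_real_affine[OF assms(2), of "1/a" "-b/a"] assms(1)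
  by (simp add: diff_divide_distrib add.commute)

lemma integral_dilate_square:
  assumes "a > 0"
  shows "(\<integral>x. (dilate p b a x)\<^sup>2 \<partial>lborel) = (\<integral>x. (p x)\<^sup>2 \<partial>lborel)"
  using integral_dilate[OF assms, of "\<lambda>x. (p x)\<^sup>2 / a" b] assms
  by (simp add: dilate_def power_divide)

text \<open>The supremum of the wider dilate times the \<open>L\<^sup>1\<close> norm of the narrower one; the smaller \<open>a'\<close> is
  compared with \<open>a\<close>, the smaller the overlap.\<close>

lemma dilate_overlap:
  assumes p: "integrable lborel p" "\<And>x. \<bar>p x\<bar> \<le> K" and a: "0 < a" "0 < a'"
  shows "\<bar>\<integral>x. dilate p b a x * dilate p b a' x \<partial>lborel\<bar> \<le> K * (\<integral>x. \<bar>p x\<bar> \<partial>lborel) * sqrt (a' / a)"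
proof -
  have i: "integrable lborel (\<lambda>x. \<bar>p ((x - b) / a')\<bar>)" using integrable_dilate[OF a(2) integrable_abs[OF p(1)]] .
  have K0: "K \<ge> 0" using p(2)[of 0] by (rule order_trans[OF abs_ge_zero])
  have "\<bar>\<integral>x. dilate p b a x * dilate p b a' x \<partial>lborel\<bar> \<le> (\<integral>x. \<bar>dilate p b a x * dilate p b a' x\<bar> \<partial>lborel)"
    by (rule integral_abs_bound)
  also have "\<dots> \<le> (\<integral>x. K / (sqrt a * sqrt a') * \<bar>p ((x - b) / a')\<bar> \<partial>lborel)"
  proof (rule integral_mono_AE')
    show "AE x in lborel. \<bar>dilate p b a x * dilate p b a' x\<bar> \<le> K / (sqrt a * sqrt a') * \<bar>p ((x - b) / a')\<bar>"
      using mult_right_mono[OF p(2), of "\<bar>_\<bar>"] a by (auto simp: dilate_def abs_mult divide_right_mono)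
  qed (use i K0 a in \<open>auto intro!: integrable_mult_right\<close>)
  also have "\<dots> = K / (sqrt a * sqrt a') * (a' * (\<integral>x. \<bar>p x\<bar> \<partial>lborel))"
    using integral_dilate[OF a(2), of "\<lambda>x. \<bar>p x\<bar>" b] by simp
  also have "\<dots> = K * (\<integral>x. \<bar>p x\<bar> \<partial>lborel) * (a' / sqrt a' / sqrt a)" by (simp add: mult_ac)
  also have "a' / sqrt a' = sqrt a'" using a by (simp add: real_div_sqrt)
  finally show ?thesis by (simp add: real_sqrt_divide)
qed

text \<open>With the scales \<open>4\<close> to the power \<open>- n\<^sup>2\<close>, the square root of the ratio of two distinct scales is at most
  \<open>(1/2) ^ (n + m)\<close>, because \<open>m\<^sup>2 - n\<^sup>2 \<ge> n + m\<close> for \<open>n < m\<close>. This makes the correlations summable as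
  required by \<open>gaussian_infinitely_often_nonpos\<close>.\<close>

lemma white_noise_real_infinitely_often_nonpos:
  fixes p :: "real \<Rightarrow> real"
  assumes wn: "gaussian_white_noise M s w" and p: "(\<lambda>x. complex_of_real (p x)) \<in> schwartz"
  defines "a \<equiv> \<lambda>n::nat. (1/4::real) ^ (n\<^sup>2)"
  shows "AE \<xi> in M. \<exists>\<^sub>F n in sequentially. Re (w \<xi> (\<lambda>x. of_real (dilate p b (a n) x))) \<le> 0"
proof -
  interpret prob_space M using wn by (simp add: gaussian_white_noise_def)
  have a: "a n > 0" for n by (simp add: a_def)
  define P where "P n = dilate p b (a n)" for n
  have P_eq: "(\<lambda>x. complex_of_real (P n x)) = wavelet (\<lambda>x. of_real (p x)) (a n) b" for n
    by (simp add: P_def dilate_def wavelet_def fun_eq_iff scaleR_conv_of_real)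
  have P: "(\<lambda>x. complex_of_real (P n x)) \<in> schwartz" for n
    unfolding P_eq by (rule schwartz_wavelet[OF p a])
  define X where "X n \<xi> = Re (w \<xi> (\<lambda>x. of_real (P n x)))" for n \<xi>
  have [measurable]: "X n \<in> borel_measurable M" for n
  proof -
    have "w \<in> M \<rightarrow>\<^sub>M cylinder_space schwartz real_tempered" using wn by (simp add: gaussian_white_noise_def)
    from measurable_evaluation[OF this P] show ?thesis unfolding X_def by measurable
  qed
  define R where "R = (\<integral>x. (p x)\<^sup>2 \<partial>lborel)"
  define G where "G n m = (\<integral>x. P n x * P m x \<partial>lborel)" for n m
  have R: "(\<integral>x. (P n x)\<^sup>2 \<partial>lborel) = R" for n
    unfolding R_def P_def by (rule integral_dilate_square[OF a])
  have [measurable]: "p \<in> borel_measurable borel"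
  proof -
    have "(\<lambda>x. Re (of_real (p x))) \<in> borel_measurable borel" using schwartz_measurable[OF p] by measurable
    then show ?thesis by simp
  qed
  have ip: "integrable lborel p" using integrable_Re[OF schwartz_integrable[OF p, of 0]] by simp
  obtain K where K: "\<And>x. \<bar>p x\<bar> \<le> K" using schwartz_bound[OF p, of 0] by auto
  have K0: "K \<ge> 0" using K[of 0] by (rule order_trans[OF abs_ge_zero])
  have ip2: "integrable lborel (\<lambda>x. (p x)\<^sup>2)"
  proof (rule Bochner_Integration.integrable_bound[OF integrable_mult_right[OF integrable_abs[OF ip], of K]])
    show "AE x in lborel. norm ((p x)\<^sup>2) \<le> norm (K * \<bar>p x\<bar>)"
    proof (rule AE_I2)
      fix x
      have "\<bar>p x\<bar> * \<bar>p x\<bar> \<le> K * \<bar>p x\<bar>" by (rule mult_right_mono[OF K]) simp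
      then show "norm ((p x)\<^sup>2) \<le> norm (K * \<bar>p x\<bar>)" using K0 by (simp add: power2_eq_square abs_mult)
    qed
  qed measurable
  have iP2: "integrable lborel (\<lambda>x. (P n x)\<^sup>2)" for n
    using integrable_dilate[OF a ip2, of b n] a[of n] by (simp add: P_def dilate_def power_divide)
  have PPle: "\<bar>P n x * P m x\<bar> \<le> (P n x)\<^sup>2 / 2 + (P m x)\<^sup>2 / 2" for n m x
    using sum_squares_bound[of "\<bar>P n x\<bar>" "\<bar>P m x\<bar>"] by (simp add: abs_mult)
  have iPP: "integrable lborel (\<lambda>x. P n x * P m x)" for n m
    by (rule Bochner_Integration.integrable_bound[where f="\<lambda>x. (P n x)\<^sup>2 / 2 + (P m x)\<^sup>2 / 2"])
      (use iP2 PPle in \<open>auto simp: P_def dilate_def\<close>)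
  have G1: "\<bar>G n m\<bar> \<le> R" for n m
  proof -
    have "\<bar>G n m\<bar> \<le> (\<integral>x. \<bar>P n x * P m x\<bar> \<partial>lborel)" unfolding G_def by (rule integral_abs_bound)
    also have "\<dots> \<le> (\<integral>x. (P n x)\<^sup>2 / 2 + (P m x)\<^sup>2 / 2 \<partial>lborel)"
      by (rule integral_mono) (use iPP iP2 PPle in auto)
    also have "\<dots> = R" using iP2 R by simp
    finally show ?thesis .
  qed
  define C where "C = K * (\<integral>x. \<bar>p x\<bar> \<partial>lborel)"
  have C0: "C \<ge> 0" unfolding C_def by (intro mult_nonneg_nonneg K0) auto
  have ratio: "sqrt (a m / a n) \<le> (1/2) ^ (n + m)" if "n < m" for n m
  proof -
    have "sqrt (1/4) = (1/2::real)" by (rule real_sqrt_unique) (auto simp: power2_eq_square)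
    moreover have "a m / a n = (1/4) ^ (m\<^sup>2 - n\<^sup>2)" unfolding a_def
      by (rule power_diff[symmetric]) (use that in \<open>auto intro: power_mono\<close>)
    ultimately have "sqrt (a m / a n) = (1/2) ^ (m\<^sup>2 - n\<^sup>2)" by (simp only: real_sqrt_power)
    also have "\<dots> \<le> (1/2) ^ (n + m)"
    proof (rule power_decreasing)
      obtain k where k: "m = n + Suc k" using \<open>n < m\<close> by (auto simp: less_iff_Suc_add)
      have "m\<^sup>2 - n\<^sup>2 = (m - n) * (n + m)" unfolding k by (simp add: power2_eq_square algebra_simps)
      also have "\<dots> \<ge> 1 * (n + m)" using that by (intro mult_right_mono) auto
      finally show "n + m \<le> m\<^sup>2 - n\<^sup>2" by simp
    qed auto
    finally show ?thesis .
  qed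
  have G2: "\<bar>G n m\<bar> \<le> C * (1/2) ^ (n + m)" if "n \<noteq> m" for n m
  proof -
    have *: "\<bar>G n m\<bar> \<le> C * (1/2) ^ (n + m)" if "n < m" for n m
    proof -
      have "\<bar>G n m\<bar> \<le> C * sqrt (a m / a n)"
        unfolding G_def C_def P_def by (rule dilate_overlap[OF ip K a a])
      also have "\<dots> \<le> C * (1/2) ^ (n + m)" by (rule mult_left_mono[OF ratio[OF that] C0])
      finally show ?thesis .
    qed
    have "G n m = G m n" unfolding G_def by (simp add: mult.commute)
    then show ?thesis using * [of n m] * [of m n] \<open>n \<noteq> m\<close> by (cases "n < m") (auto simp: add.commute)
  qed
  have char1: "(\<integral>\<xi>. iexp (t * X n \<xi>) \<partial>M) = of_real (exp (- (s\<^sup>2 / 2) * t\<^sup>2 * R))" for n t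
    unfolding X_def white_noise_char[OF wn P] R ..
  have char2: "(\<integral>\<xi>. iexp (t * (X n \<xi> - X m \<xi>)) \<partial>M) = of_real (exp (- (s\<^sup>2 / 2) * t\<^sup>2 * (2 * R - 2 * G n m)))" for n m t
  proof -
    have S: "(\<lambda>x. complex_of_real (P n x - P m x)) \<in> schwartz"
      using schwartz_add[OF P[of n] schwartz_cmult[OF P[of m], of "-1"]] by simp
    have "(\<integral>\<xi>. iexp (t * (X n \<xi> - X m \<xi>)) \<partial>M) = (\<integral>\<xi>. iexp (t * Re (w \<xi> (\<lambda>x. of_real (P n x - P m x)))) \<partial>M)"
    proof (rule Bochner_Integration.integral_cong[OF refl])
      fix \<xi> assume xi: "\<xi> \<in> space M"
      have "w \<xi> (\<lambda>x. of_real (P n x - P m x)) = w \<xi> (\<lambda>x. of_real (P n x) + (-1) * of_real (P m x))" by simp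
      also have "\<dots> = w \<xi> (\<lambda>x. of_real (P n x)) + (-1) * w \<xi> (\<lambda>x. of_real (P m x))"
        unfolding white_noise_add[OF wn xi P schwartz_cmult[OF P]] white_noise_scale[OF wn xi P] ..
      finally show "iexp (t * (X n \<xi> - X m \<xi>)) = iexp (t * Re (w \<xi> (\<lambda>x. of_real (P n x - P m x))))"
        by (simp add: X_def)
    qed
    also have "\<dots> = of_real (exp (- (s\<^sup>2 / 2) * t\<^sup>2 * (\<integral>x. (P n x - P m x)\<^sup>2 \<partial>lborel)))"
      by (rule white_noise_char[OF wn S])
    also have "(\<integral>x. (P n x - P m x)\<^sup>2 \<partial>lborel) = (\<integral>x. (P n x)\<^sup>2 + (P m x)\<^sup>2 - 2 * (P n x * P m x) \<partial>lborel)"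
      by (simp add: power2_diff mult.assoc)
    also have "\<dots> = 2 * R - 2 * G n m" using iP2 iPP R by (simp add: G_def)
    finally show ?thesis .
  qed
  have R0: "R \<ge> 0" unfolding R_def by simp
  have "AE \<xi> in M. \<exists>\<^sub>F n in sequentially. X n \<xi> \<le> 0"
  \<comment> \<open>In the degenerate case all values vanish almost surely; otherwise they are normalised to variance 1.\<close>
  proof (cases "s\<^sup>2 * R = 0")
    case True
    have "AE \<xi> in M. X n \<xi> = 0" for n
    proof -
      interpret D: real_distribution "distr M borel (X n)" by (rule real_distribution_distr) simp
      interpret Z: prob_space "return borel (0::real)" by (rule prob_space_return) simp
      have rd: "real_distribution (return borel (0::real))"
        by unfold_locales auto
      have "char (distr M borel (X n)) t = char (return borel 0) t" for t
      proof -
        have "char (distr M borel (X n)) t = (\<integral>\<xi>. iexp (t * X n \<xi>) \<partial>M)"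
          unfolding char_def by (subst integral_distr) auto
        also have "\<dots> = 1" unfolding char1 using True by auto
        also have "\<dots> = char (return borel 0) t" unfolding char_def by (subst integral_return) auto
        finally show ?thesis .
      qed
      then have eq: "distr M borel (X n) = return borel 0"
        by (intro Levy_uniqueness D.real_distribution_axioms rd ext)
      have "AE x in return borel (0::real). x = 0" by (subst AE_return) auto
      then show ?thesis unfolding eq[symmetric] by (subst (asm) AE_distr_iff) auto
    qed
    then have "AE \<xi> in M. \<forall>n. X n \<xi> = 0" by (subst AE_all_countable) auto
    then show ?thesis by eventually_elim auto
  next
    case False
    then have sR: "s\<^sup>2 * R > 0" "R > 0" using R0 by (auto simp: less_le)
    define v where "v = sqrt (s\<^sup>2 * R)"
    have v: "v > 0" "v\<^sup>2 = s\<^sup>2 * R" using sR by (auto simp: v_def)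
    have "AE \<xi> in M. \<exists>\<^sub>F n in sequentially. X n \<xi> / v \<le> 0"
    proof (rule gaussian_infinitely_often_nonpos[where \<rho>="\<lambda>n m. G n m / R" and C="C / R"])
      show "(\<integral>\<xi>. iexp (t * (X n \<xi> / v)) \<partial>M) = of_real (exp (- t\<^sup>2 / 2))" for n t
      proof -
        have "- (s\<^sup>2 / 2) * (t / v)\<^sup>2 * R = - (t / v)\<^sup>2 * v\<^sup>2 / 2" unfolding v(2) by simp
        also have "\<dots> = - t\<^sup>2 / 2" using v(1) by (simp add: power_divide)
        finally show ?thesis using char1[of "t / v" n] by simp
      qed
      show "(\<integral>\<xi>. iexp (t * (X n \<xi> / v - X m \<xi> / v)) \<partial>M) = of_real (exp (- t\<^sup>2 * (1 - G n m / R)))" for n m t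
      proof -
        have "- (s\<^sup>2 / 2) * u * (2 * R - 2 * G n m) = - u * (s\<^sup>2 * R) * (1 - G n m / R)" for u
          using sR by (simp add: field_simps)
        then have "- (s\<^sup>2 / 2) * (t / v)\<^sup>2 * (2 * R - 2 * G n m) = - (t / v)\<^sup>2 * v\<^sup>2 * (1 - G n m / R)"
          unfolding v(2) .
        also have "\<dots> = - t\<^sup>2 * (1 - G n m / R)" using v(1) by (simp add: power_divide)
        finally have E: "- (s\<^sup>2 / 2) * (t / v)\<^sup>2 * (2 * R - 2 * G n m) = - t\<^sup>2 * (1 - G n m / R)" .
        have "t * (X n \<xi> / v - X m \<xi> / v) = t / v * (X n \<xi> - X m \<xi>)" for \<xi>
          by (simp add: diff_divide_distrib right_diff_distrib)
        then show ?thesis using char2[of "t / v" n m] unfolding E by (simp only:)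
      qed
      show "\<bar>G n m / R\<bar> \<le> 1" for n m using G1[of n m] sR by (simp add: abs_divide)
      show "\<bar>G n m / R\<bar> \<le> C / R * (1/2) ^ (n + m)" if "n \<noteq> m" for n m
        using divide_right_mono[OF G2[OF that], of R] sR by (simp add: abs_divide)
    qed measurable
    then show ?thesis using v(1) by (simp add: divide_le_0_iff)
  qed
  then show ?thesis unfolding X_def P_def .
qed
text \<open>Every nonzero \<open>l\<close> has \<open>Re (c * l) > 0\<close> for one of four rotations \<open>c\<close>, and \<open>c\<close> can be moved into the test
  function.\<close>

lemma white_noise_sgn_limit:
  assumes wn: "gaussian_white_noise M s w" and \<theta>: "\<theta> \<in> schwartz"
  shows "AE \<xi> in M. \<forall>l. ((\<lambda>a. sgn (w \<xi> (wavelet \<theta> a b))) \<longlongrightarrow> l) (at_right 0) \<longrightarrow> l = 0"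
proof -
  define a where "a n = (1/4::real) ^ (n\<^sup>2)" for n :: nat
  have a: "a n > 0" for n by (simp add: a_def)
  have a_lim: "filterlim a (at_right 0) sequentially"
  proof -
    have "filterlim (\<lambda>n::nat. n\<^sup>2) sequentially sequentially"
      by (rule filterlim_subseq) (auto simp: strict_mono_def power_strict_mono)
    from filterlim_compose[OF LIMSEQ_realpow_zero[of "1/4"] this] have "a \<longlonglongrightarrow> 0"
      by (simp add: a_def[abs_def])
    then show ?thesis by (rule tendsto_imp_filterlim_at_right) (simp add: a)
  qed
  define p where "p c x = Re (c * \<theta> x)" for c x
  have p: "(\<lambda>x. complex_of_real (p c x)) \<in> schwartz" for c
    unfolding p_def by (rule schwartz_Re[OF schwartz_cmult[OF \<theta>]])
  have eq: "Re (w \<xi> (\<lambda>x. of_real (dilate (p c) b (a n) x))) = Re (c * w \<xi> (wavelet \<theta> (a n) b))"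
    if xi: "\<xi> \<in> space M" for \<xi> c n
  proof -
    have W: "wavelet \<theta> (a n) b \<in> schwartz" by (rule schwartz_wavelet[OF \<theta> a])
    have "(\<lambda>x. complex_of_real (dilate (p c) b (a n) x)) = (\<lambda>x. of_real (Re (c * wavelet \<theta> (a n) b x)))"
      by (simp add: dilate_def p_def wavelet_def fun_eq_iff)
    then show ?thesis
      using white_noise_Re[OF wn xi schwartz_cmult[OF W, of c]] white_noise_scale[OF wn xi W, of c] by simp
  qed
  have io: "AE \<xi> in M. \<exists>\<^sub>F n in sequentially. Re (c * w \<xi> (wavelet \<theta> (a n) b)) \<le> 0" for c
    using white_noise_real_infinitely_often_nonpos[OF wn p[of c], where b=b, folded a_def] AE_space
    by eventually_elim (simp add: eq)
  have "AE \<xi> in M. \<forall>c\<in>{1, -1, \<i>, -\<i>}. \<exists>\<^sub>F n in sequentially. Re (c * w \<xi> (wavelet \<theta> (a n) b)) \<le> 0"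
    by (rule AE_finite_allI) (use io in auto)
  then show ?thesis
  proof eventually_elim
    case (elim \<xi>)
    show ?case
    proof (intro allI impI, rule ccontr)
      fix l assume l: "((\<lambda>a. sgn (w \<xi> (wavelet \<theta> a b))) \<longlongrightarrow> l) (at_right 0)" and "l \<noteq> 0"
      then have "Re l > 0 \<or> Re l < 0 \<or> Im l > 0 \<or> Im l < 0" by (auto simp: complex_eq_iff)
      then obtain c where c: "c \<in> {1, -1, \<i>, -\<i>}" "Re (c * l) > 0" by force
      have "(\<lambda>n. Re (c * sgn (w \<xi> (wavelet \<theta> (a n) b)))) \<longlonglongrightarrow> Re (c * l)"
        by (intro tendsto_intros filterlim_compose[OF l a_lim])
      then have "\<forall>\<^sub>F n in sequentially. Re (c * sgn (w \<xi> (wavelet \<theta> (a n) b))) > 0"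
        using c(2) by (rule order_tendstoD)
      then have "\<forall>\<^sub>F n in sequentially. \<not> Re (c * w \<xi> (wavelet \<theta> (a n) b)) \<le> 0"
      proof eventually_elim
        case (elim n)
        define z where "z = w \<xi> (wavelet \<theta> (a n) b)"
        have "c * sgn z = (c * z) / of_real (cmod z)" by (simp add: sgn_eq)
        then have "Re (c * sgn z) = Re (c * z) / cmod z" by (simp only: Re_divide_of_real)
        then show ?case using elim by (simp add: z_def zero_less_divide_iff not_le)
      qed
      then show False using elim c(1) by (auto simp: frequently_def)
    qed
  qed
qed

lemma signature_eq_0I:
  assumes "\<And>l. ((\<lambda>a. sgn (f (wavelet \<kappa> a b))) \<longlongrightarrow> l) (at_right 0) \<Longrightarrow> l = 0"
  shows "signature \<kappa> f b = 0"
  using assms unfolding signature_def by (auto intro!: tendsto_Lim)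

section \<open>The signature of white noise and of fractional Brownian motion\<close>

theorem theorem6p1:
  fixes M :: "'a measure" and \<kappa> :: "real \<Rightarrow> complex"
  assumes "signature_wavelet \<kappa>"
  shows "(\<forall>s w. gaussian_white_noise M s w \<longrightarrow>
            (\<forall>b. AE \<xi> in M. signature \<kappa> (w \<xi>) b = 0)) \<and>
         (\<forall>\<gamma> B. 0 \<le> \<gamma> \<longrightarrow> fractional_brownian_motion M \<gamma> B \<longrightarrow>
            (\<forall>b. AE \<xi> in M. signature \<kappa> (B \<xi>) b = 0))"
proof (intro conjI allI impI)
  fix s w b assume wn: "gaussian_white_noise M s w"
  have "\<kappa> \<in> schwartz" using assms by (simp add: signature_wavelet_def)
  from white_noise_sgn_limit[OF wn this, of b] show "AE \<xi> in M. signature \<kappa> (w \<xi>) b = 0"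
    by eventually_elim (blast intro: signature_eq_0I)
next
  fix \<gamma> B b assume B: "fractional_brownian_motion M \<gamma> B"
  then obtain s w where wn: "gaussian_white_noise M s w"
    and D: "AE \<xi> in M. frac_D \<gamma> (B \<xi>) = mod_poly (w \<xi>)"
    and meas: "B \<in> M \<rightarrow>\<^sub>M cylinder_space schwartz_moment0 tempered_mod_poly"
    unfolding fractional_brownian_motion_def by blast
  obtain \<theta> where \<theta>: "\<theta> \<in> schwartz"
    and rel: "\<And>f g a b. \<lbrakk>f \<in> tempered_mod_poly; frac_D \<gamma> f = mod_poly g; a > 0\<rbrakk>
       \<Longrightarrow> f (wavelet \<kappa> a b) = of_real (a powr \<gamma>) * g (wavelet \<theta> a b)"
    using fractional_integral_wavelet[OF assms, where \<gamma>=\<gamma>] by blast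
  show "AE \<xi> in M. signature \<kappa> (B \<xi>) b = 0"
    using white_noise_sgn_limit[OF wn \<theta>, of b] D AE_space
  proof eventually_elim
    case (elim \<xi>)
    have "B \<xi> \<in> space (cylinder_space schwartz_moment0 tempered_mod_poly)"
      using measurable_space[OF meas elim(3)] .
    then have T: "B \<xi> \<in> tempered_mod_poly" by (simp add: cylinder_space_def space_restrict_space)
    show ?case
    proof (rule signature_eq_0I)
      fix l assume l: "((\<lambda>a. sgn (B \<xi> (wavelet \<kappa> a b))) \<longlongrightarrow> l) (at_right 0)"
      have "\<forall>\<^sub>F a in at_right 0. sgn (B \<xi> (wavelet \<kappa> a b)) = sgn (w \<xi> (wavelet \<theta> a b))"
        using eventually_at_right_less[of "0::real"]
      proof eventually_elim
        case (elim a)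
        have "sgn (complex_of_real (a powr \<gamma>)) = 1" using elim by (simp add: sgn_of_real)
        then show ?case using rel[OF T \<open>frac_D \<gamma> (B \<xi>) = mod_poly (w \<xi>)\<close> elim, of b] by (simp add: sgn_mult)
      qed
      from tendsto_cong[OF this] l elim(1) show "l = 0" by blast
    qed
  qed
qed
end
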